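(* Suppose that $x=x^*$ is a self-adjoint element in a unital C$^*$-algebra $\mathcal A$ and $\sigma(x)$ is the spectrum of $x$ in $\mathcal A$. Let $d(\sigma(x))$ be the packing dimension of the set $\sigma(x)$ in $\mathbb R$. Let $f:\mathbb N\times\mathbb N\times\mathbb R^+\to\mathbb R$ be defined by $$f(s,k,\omega)=\frac{\log\left(\frac{\log s}{\log k}\right)}{-\log\omega}$$ for $s,k\in\mathbb N$, $\omega>0$. Then the topological $f$-free-orbit-dimension of $x$ satisfies $$\mathfrak k_f(x)=d(\sigma(x)).$$
   Context: Packing dimension: for a subset $K$ of a metric space $(X,d)$ and $\omega>0$, $P(K,\omega)$ is the maximal cardinality of a subset $F\subseteq K$ such that for all $a,b\in F$ either $a=b$ or $d(a,b)\ge\omega$; the packing dimension of $K$ is $d(K)=\limsup_{\omega\to0^+}\frac{\log P(K,\omega)}{-\log\omega}$. Norm-microstates: let $\{P_r\}_{r=1}^\infty$ be the collection (enumerated) of all polynomials in $\mathbb C\langle X\rangle$ (constant terms allowed, evaluated as multiples of the identity) whose coefficients have rational real and imaginary parts. For $R,\epsilon>0$ and integers $r,k\ge1$, $\Gamma^{(top)}_R(x;k,\epsilon,P_1,\ldots,P_r)$ is the set of self-adjoint $A\in\mathcal M_k(\mathbb C)$ (the $k\times k$ complex matrices) with $\|A\|\le R$ and $|\|P_j(A)\|-\|P_j(x)\||\le\epsilon$ for $1\le j\le r$ (operator norms). Orbit covering: for $B\in\mathcal M_k(\mathbb C)$ and $\omega>0$ the $\omega$-orbit-$\|\cdot\|$-ball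 centered at $B$ is the set of $A\in\mathcal M_k(\mathbb C)$ such that $\|A-WBW^*\|<\omega$ for some unitary $W\in\mathcal M_k(\mathbb C)$. $o_\infty(\Sigma,\omega)$ is the minimal number of $\omega$-orbit-$\|\cdot\|$-balls with centers in $\Sigma$ that cover $\Sigma$. Topological $f$-free-orbit-dimension: $$\mathfrak k_f(x)=\limsup_{\omega\to0^+}\ \sup_{R>0}\ \inf_{r\in\mathbb N,\,\epsilon>0}\ \limsup_{k\to\infty} f\big(o_\infty(\Gamma^{(top)}_R(x;k,\epsilon,P_1,\ldots,P_r),\omega),k,\omega\big).$$ *)

theory Defs
  imports
    "HOL-Analysis.Analysis"
    "HOL-Computational_Algebra.Polynomial"
    "Jordan_Normal_Form.Schur_Decomposition"
begin

section \<open>Unital C*-algebras\<close>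

text \<open>The real structure (norm, completeness, unit of norm 1) comes from the library classes; the
  complex scalar multiplication must restrict to the given real one.\<close>

class unital_cstar_algebra = real_normed_algebra_1 + banach +
  fixes cscale :: "complex \<Rightarrow> 'a \<Rightarrow> 'a" (infixr "*\<^sub>c" 75)
    and star :: "'a \<Rightarrow> 'a"
  assumes cscale_add_right: "a *\<^sub>c (x + y) = a *\<^sub>c x + a *\<^sub>c y"
    and cscale_add_left: "(a + b) *\<^sub>c x = a *\<^sub>c x + b *\<^sub>c x"
    and cscale_cscale: "a *\<^sub>c b *\<^sub>c x = (a * b) *\<^sub>c x"
    and cscale_of_real: "complex_of_real r *\<^sub>c x = r *\<^sub>R x"
    and cscale_mult_left: "(a *\<^sub>c x) * y = a *\<^sub>c (x * y)"
    and cscale_mult_right: "x * (a *\<^sub>c y) = a *\<^sub>c (x * y)"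
    and norm_cscale: "norm (a *\<^sub>c x) = cmod a * norm x"
    and star_star: "star (star x) = x"
    and star_add: "star (x + y) = star x + star y"
    and star_cscale: "star (a *\<^sub>c x) = cnj a *\<^sub>c star x"
    and star_mult: "star (x * y) = star y * star x"
    and cstar_identity: "norm (star x * x) = (norm x)\<^sup>2"

instantiation complex :: unital_cstar_algebra
begin

definition cscale_complex :: "complex \<Rightarrow> complex \<Rightarrow> complex"
  where "cscale_complex a x = a * x"

definition star_complex :: "complex \<Rightarrow> complex"
  where "star_complex = cnj"

instance
  by standard (auto simp: cscale_complex_def star_complex_def algebra_simps norm_mult
    power2_eq_square scaleR_conv_of_real)

end

definition self_adjoint :: "'a::unital_cstar_algebra \<Rightarrow> bool"
  where "self_adjoint x \<longleftrightarrow> star x = x"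

definition spectrum_of :: "'a::unital_cstar_algebra \<Rightarrow> complex set"
  where "spectrum_of x =
    {z. \<not> (\<exists>y. (x - z *\<^sub>c 1) * y = 1 \<and> y * (x - z *\<^sub>c 1) = 1)}"

text \<open>The spectrum of a self-adjoint element is real; \<open>real_spectrum\<close> is that same set as a subset of
  the real line.\<close>

definition real_spectrum :: "'a::unital_cstar_algebra \<Rightarrow> real set"
  where "real_spectrum x = {t. complex_of_real t \<in> spectrum_of x}"

definition poly_eval :: "complex poly \<Rightarrow> 'a::unital_cstar_algebra \<Rightarrow> 'a"
  where "poly_eval p x = (\<Sum>n\<le>degree p. coeff p n *\<^sub>c x ^ n)"


section \<open>Packing dimension\<close>

definition separated :: "real \<Rightarrow> 'a::metric_space set \<Rightarrow> bool"
  where "separated \<omega> F \<longleftrightarrow> (\<forall>a\<in>F. \<forall>b\<in>F. a = b \<or> dist a b \<ge> \<omega>)"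

text \<open>The value is infinite when there are arbitrarily large finite separated subsets.\<close>

definition packing_number :: "'a::metric_space set \<Rightarrow> real \<Rightarrow> enat"
  where "packing_number K \<omega> =
    Sup {enat (card F) | F. finite F \<and> F \<subseteq> K \<and> separated \<omega> F}"

definition ln_enat :: "enat \<Rightarrow> ereal"
  where "ln_enat n =
    (case n of enat m \<Rightarrow> if m = 0 then -\<infinity> else ereal (ln (real m)) | \<infinity> \<Rightarrow> \<infinity>)"

definition packing_dim :: "'a::metric_space set \<Rightarrow> ereal"
  where "packing_dim K =
    Limsup (at_right 0) (\<lambda>\<omega>. ln_enat (packing_number K \<omega>) / ereal (- ln \<omega>))"


section \<open>Complex matrices\<close>

definition vec_l2_norm :: "complex vec \<Rightarrow> real"
  where "vec_l2_norm v = sqrt (\<Sum>i<dim_vec v. (cmod (v $ i))\<^sup>2)"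

definition mat_op_norm :: "complex mat \<Rightarrow> real"
  where "mat_op_norm A =
    Sup {vec_l2_norm (A *\<^sub>v v) | v. v \<in> carrier_vec (dim_col A) \<and> vec_l2_norm v \<le> 1}"

definition is_unitary :: "nat \<Rightarrow> complex mat \<Rightarrow> bool"
  where "is_unitary k W \<longleftrightarrow>
    W \<in> carrier_mat k k \<and> W * mat_adjoint W = 1\<^sub>m k \<and> mat_adjoint W * W = 1\<^sub>m k"

text \<open>Matrices of varying size do not form a commutative monoid, so the evaluation of a polynomial at
  a \<open>k \<times> k\<close> matrix is written entrywise; the constant term contributes a multiple of \<open>1\<^sub>m k\<close>.\<close>

definition mat_poly_eval :: "nat \<Rightarrow> complex poly \<Rightarrow> complex mat \<Rightarrow> complex mat"
  where "mat_poly_eval k p A =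
    mat k k (\<lambda>(i, j). \<Sum>n\<le>degree p. coeff p n * (A ^\<^sub>m n) $$ (i, j))"


section \<open>Norm-microstates and topological free-orbit-dimension\<close>

text \<open>Indices start at 1. Every polynomial with coefficients in \<open>\<rat> + i\<rat>\<close>, and no other, occurs;
  repetitions are allowed.\<close>

definition enumerates_rational_polys :: "(nat \<Rightarrow> complex poly) \<Rightarrow> bool"
  where "enumerates_rational_polys P \<longleftrightarrow>
    P ` {1..} = {p. \<forall>n. Re (coeff p n) \<in> \<rat> \<and> Im (coeff p n) \<in> \<rat>}"

definition norm_microstates ::
  "(nat \<Rightarrow> complex poly) \<Rightarrow> 'a::unital_cstar_algebra \<Rightarrow> real \<Rightarrow> nat \<Rightarrow> real \<Rightarrow> nat \<Rightarrow> complex mat set"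
  where "norm_microstates P x R k \<epsilon> r =
    {A \<in> carrier_mat k k. mat_adjoint A = A \<and> mat_op_norm A \<le> R \<and>
      (\<forall>j\<in>{1..r}. \<bar>mat_op_norm (mat_poly_eval k (P j) A) - norm (poly_eval (P j) x)\<bar> \<le> \<epsilon>)}"

definition orbit_ball :: "nat \<Rightarrow> complex mat \<Rightarrow> real \<Rightarrow> complex mat set"
  where "orbit_ball k B \<omega> =
    {A \<in> carrier_mat k k. \<exists>W. is_unitary k W \<and> mat_op_norm (A - W * B * mat_adjoint W) < \<omega>}"

text \<open>Meant for sets \<open>S\<close> of \<open>k \<times> k\<close> matrices that are bounded in norm, such as the microstate
  sets: these always have a finite cover, so the infimum is a minimum.\<close>

definition orbit_covering_number :: "nat \<Rightarrow> complex mat set \<Rightarrow> real \<Rightarrow> nat"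
  where "orbit_covering_number k S \<omega> =
    Inf {card C | C. finite C \<and> C \<subseteq> S \<and> S \<subseteq> (\<Union>B\<in>C. orbit_ball k B \<omega>)}"

text \<open>The gauge function \<open>f\<close> is real-valued, while the limits superior, suprema and infima are
  taken in the extended reals. When \<open>f\<close> is built from logarithms, its values at degenerate
  covering numbers are thus also real numbers, given by the convention \<open>ln 0 = 0\<close>.\<close>

definition top_free_orbit_dim ::
  "(nat \<Rightarrow> complex poly) \<Rightarrow> (nat \<Rightarrow> nat \<Rightarrow> real \<Rightarrow> real) \<Rightarrow> 'a::unital_cstar_algebra \<Rightarrow> ereal"
  where "top_free_orbit_dim P f x =
    Limsup (at_right 0) (\<lambda>\<omega>. SUP R\<in>{0<..}. INF (r, \<epsilon>)\<in>{1..} \<times> {0<..}.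
      limsup (\<lambda>k. ereal (f (orbit_covering_number k (norm_microstates P x R k \<epsilon> r) \<omega>) k \<omega>)))"

end

theory Submission
  imports Defs "HOL-Real_Asymp.Real_Asymp"
begin

text \<open>
  Write \<open>K\<close> for the spectrum of \<open>x\<close> and \<open>N(\<omega>)\<close> for its packing number at scale \<open>\<omega>\<close>. Up to
  unitary conjugation a self-adjoint matrix is the list of its eigenvalues with multiplicities. For a
  norm-microstate of \<open>x\<close> with good parameters all eigenvalues lie close to \<open>K\<close>, and any distribution
  of multiplicities over points of \<open>K\<close> that visits finitely many prescribed points is realised by a
  microstate. At resolution \<open>\<omega>\<close> the unitary orbits of \<open>k \<times> k\<close> microstates are therefore
  counted by the ways to distribute \<open>k\<close> eigenvalues over about \<open>N(\<omega>)\<close> cells, and this number grows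
  like a power of \<open>k\<close> with an exponent of about \<open>N(\<omega>)\<close>. The gauge \<open>ln (ln s / ln k) / (- ln \<omega>)\<close> turns it into
  \<open>ln N(\<omega>) / (- ln \<omega>)\<close> as \<open>k\<close> tends to infinity, and the constant factors lost in \<open>\<omega>\<close>
  and in \<open>N(\<omega>)\<close> vanish as \<open>\<omega>\<close> tends to \<open>0\<close>.

  The link between \<open>x\<close> and matrices is the identity \<open>\<parallel>p(x)\<parallel> = max {\<bar>p t\<bar> | t \<in> K}\<close>
  (\<open>poly_real_spectrum_le\<close> and \<open>poly_real_spectrum_attained\<close>). Through the spectral mapping theorem it
  reduces to the fact that \<open>\<parallel>h\<parallel>\<close> or \<open>- \<parallel>h\<parallel>\<close> lies in the spectrum of a self-adjoint
  \<open>h\<close>. That is obtained by averaging resolvents over roots of unity (\<open>averaged_inverses\<close>).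

  Upper bound (\<open>microstate_covering_number_upper\<close>). Finitely many polynomials \<open>C - (X - q)\<^sup>2\<close>
  keep the eigenvalues within \<open>\<omega>/8\<close> of \<open>K\<close>; rounding them to a maximal \<open>\<omega>/4\<close>-separated subset of
  \<open>K\<close> leaves at most \<open>(k + 1)\<close> to the power \<open>N(\<omega>/4)\<close> vectors of multiplicities, and matrices
  with the same vector lie in one orbit ball (\<open>orbit_cover_exists\<close>).

  Lower bound (\<open>microstate_covering_number_lower\<close>). If two matrices lie in one orbit ball, each number of
  eigenvalues up to \<open>t\<close> of the one is at most the number of eigenvalues below \<open>t + 2\<omega>\<close> of the other,
  by Weyl's inequality (\<open>eigenvalue_count_le\<close>). Diagonal matrices with spectrum in a
  \<open>2\<omega>\<close>-separated subset of \<open>K\<close>, up to a bounded number of eigenvalues and with multiplicities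
  in an arithmetic progression whose difference exceeds that number, thus need different balls, and there
  are at least a constant times \<open>k\<close> to the power \<open>N(2\<omega>) - 1\<close> of them. The bound degenerates when
  \<open>N(2\<omega>) = 1\<close>; then the supremum over \<open>R\<close> is bounded below through a tiny \<open>R\<close>, for which one ball
  covers everything and the gauge is \<open>0\<close> (\<open>orbit_covering_number_small_radius\<close>).
\<close>

unbundle no vec_syntax and no inner_syntax

section \<open>The norm of a polynomial in a self-adjoint element\<close>

subsection \<open>Scalars and the involution\<close>

lemma cscale_zero_left [simp]: "0 *\<^sub>c x = (0::'a::unital_cstar_algebra)"
  using cscale_of_real[of 0 x] by simp

lemma cscale_one [simp]: "1 *\<^sub>c x = (x::'a::unital_cstar_algebra)"
  using cscale_of_real[of 1 x] by simp

lemma cscale_zero_right [simp]: "a *\<^sub>c 0 = (0::'a::unital_cstar_algebra)"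
  using cscale_cscale[of a 0 "0::'a"] by simp

lemma cscale_minus_left: "(- a) *\<^sub>c x = - (a *\<^sub>c (x::'a::unital_cstar_algebra))"
  using cscale_add_left[of a "- a" x] by (simp add: eq_neg_iff_add_eq_0 add.commute)

lemma cscale_minus_right: "a *\<^sub>c (- x) = - (a *\<^sub>c (x::'a::unital_cstar_algebra))"
  using cscale_add_right[of a x "- x"] by (simp add: eq_neg_iff_add_eq_0 add.commute)

lemma cscale_diff_left: "(a - b) *\<^sub>c x = a *\<^sub>c x - b *\<^sub>c (x::'a::unital_cstar_algebra)"
  using cscale_add_left[of a "- b" x] by (simp add: cscale_minus_left)

lemma cscale_diff_right: "a *\<^sub>c (x - y) = a *\<^sub>c x - a *\<^sub>c (y::'a::unital_cstar_algebra)"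
  using cscale_add_right[of a x "- y"] by (simp add: cscale_minus_right)

lemma cscale_sum_right: "a *\<^sub>c sum g S = (\<Sum>i\<in>S. a *\<^sub>c (g i :: 'a::unital_cstar_algebra))"
  by (induction S rule: infinite_finite_induct) (simp_all add: cscale_add_right)

lemma star_one [simp]: "star (1::'a::unital_cstar_algebra) = 1"
  by (metis mult.right_neutral star_mult star_star)

lemma star_zero [simp]: "star (0::'a::unital_cstar_algebra) = 0"
  using star_add[of 0 "0::'a"] by simp

lemma star_minus: "star (- x) = - star (x::'a::unital_cstar_algebra)"
  using star_add[of x "- x"] by (simp add: eq_neg_iff_add_eq_0 add.commute)

lemma star_diff: "star (x - y) = star x - star (y::'a::unital_cstar_algebra)"
  using star_add[of x "- y"] by (simp add: star_minus)

lemma star_sum: "star (sum g S) = (\<Sum>i\<in>S. star (g i :: 'a::unital_cstar_algebra))"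
  by (induction S rule: infinite_finite_induct) (simp_all add: star_add)

lemma star_power: "star (x ^ n) = star (x::'a::unital_cstar_algebra) ^ n"
  by (induction n) (simp_all add: star_mult power_commutes)

lemma star_scaleR: "star (r *\<^sub>R x) = r *\<^sub>R star (x::'a::unital_cstar_algebra)"
  by (simp flip: cscale_of_real add: star_cscale)

subsection \<open>Evaluation of polynomials\<close>

lemma poly_eval_altdef:
  fixes x :: "'a::unital_cstar_algebra"
  assumes "degree p \<le> m"
  shows "poly_eval p x = (\<Sum>n\<le>m. coeff p n *\<^sub>c x ^ n)"
  unfolding poly_eval_def
  by (rule sum.mono_neutral_left) (use assms in \<open>auto simp: coeff_eq_0\<close>)

lemma poly_eval_0 [simp]: "poly_eval 0 x = (0::'a::unital_cstar_algebra)"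
  by (simp add: poly_eval_def)

lemma poly_eval_pCons [simp]:
  fixes x :: "'a::unital_cstar_algebra"
  shows "poly_eval (pCons a p) x = a *\<^sub>c 1 + x * poly_eval p x"
proof -
  have "poly_eval (pCons a p) x = (\<Sum>n\<le>Suc (degree p). coeff (pCons a p) n *\<^sub>c x ^ n)"
    by (rule poly_eval_altdef) (rule degree_pCons_le)
  also have "\<dots> = a *\<^sub>c 1 + (\<Sum>n\<le>degree p. x * (coeff p n *\<^sub>c x ^ n))"
    by (subst sum.atMost_Suc_shift) (simp add: cscale_mult_right)
  finally show ?thesis
    by (simp add: poly_eval_def sum_distrib_left)
qed

lemma poly_eval_add:
  fixes x :: "'a::unital_cstar_algebra"
  shows "poly_eval (p + q) x = poly_eval p x + poly_eval q x"
proof -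
  let ?m = "max (degree p) (degree q)"
  have "degree (p + q) \<le> ?m"
    by (rule degree_add_le_max)
  then show ?thesis
    using poly_eval_altdef[of "p + q" ?m x] poly_eval_altdef[of p ?m x] poly_eval_altdef[of q ?m x]
    by (simp add: cscale_add_left sum.distrib)
qed

lemma poly_eval_smult:
  fixes x :: "'a::unital_cstar_algebra"
  shows "poly_eval (Polynomial.smult a p) x = a *\<^sub>c poly_eval p x"
  using poly_eval_altdef[of "Polynomial.smult a p" "degree p" x]
  by (simp add: poly_eval_def cscale_sum_right cscale_cscale degree_smult_le)

lemma poly_eval_mult:
  fixes x :: "'a::unital_cstar_algebra"
  shows "poly_eval (p * q) x = poly_eval p x * poly_eval q x"
  by (induction p)
    (simp_all add: poly_eval_add poly_eval_smult distrib_right cscale_mult_left mult.assoc)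

lemma poly_eval_diff:
  fixes x :: "'a::unital_cstar_algebra"
  shows "poly_eval (p - q) x = poly_eval p x - poly_eval q x"
  using poly_eval_add[of "p - q" q x] by simp

lemma poly_eval_map_cnj:
  fixes x :: "'a::unital_cstar_algebra"
  assumes "self_adjoint x"
  shows "poly_eval (map_poly cnj p) x = star (poly_eval p x)"
  using assms
  by (simp add: poly_eval_def self_adjoint_def star_sum star_cscale star_power degree_map_poly
      coeff_map_poly)

subsection \<open>Invertible elements and the spectrum\<close>

definition invertible_elem :: "'a::monoid_mult \<Rightarrow> bool"
  where "invertible_elem y \<longleftrightarrow> (\<exists>z. y * z = 1 \<and> z * y = 1)"

lemma spectrum_of_iff: "z \<in> spectrum_of x \<longleftrightarrow> \<not> invertible_elem (x - z *\<^sub>c 1)"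
  by (simp add: spectrum_of_def invertible_elem_def)

lemma invertible_elem_mult:
  assumes "invertible_elem y" "invertible_elem z"
  shows "invertible_elem (y * z)"
proof -
  obtain u v where "y * u = 1" "u * y = 1" "z * v = 1" "v * z = 1"
    using assms by (auto simp: invertible_elem_def)
  then have "(y * z) * (v * u) = 1" "(v * u) * (y * z) = 1"
    by (metis mult.assoc mult.right_neutral)+
  then show ?thesis
    by (auto simp: invertible_elem_def)
qed

lemma invertible_elem_cscale:
  fixes y :: "'a::unital_cstar_algebra"
  assumes "a \<noteq> 0"
  shows "invertible_elem (a *\<^sub>c y) \<longleftrightarrow> invertible_elem y"
proof -
  have *: "invertible_elem (b *\<^sub>c u)" if b: "b \<noteq> 0" and u: "invertible_elem u" for b and u :: 'a
  proof -
    obtain v where "u * v = 1" "v * u = 1"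
      using u by (auto simp: invertible_elem_def)
    then have "(b *\<^sub>c u) * (inverse b *\<^sub>c v) = 1" "(inverse b *\<^sub>c v) * (b *\<^sub>c u) = 1"
      using \<open>b \<noteq> 0\<close> by (simp_all add: cscale_mult_left cscale_mult_right cscale_cscale)
    then show ?thesis
      by (auto simp: invertible_elem_def)
  qed
  show ?thesis
    using *[of a y] *[of "inverse a" "a *\<^sub>c y"] assms by (auto simp: cscale_cscale)
qed

lemma invertible_elem_one_minus:
  fixes y :: "'a::{real_normed_algebra_1, banach}"
  assumes "norm y < 1"
  shows "invertible_elem (1 - y)"
proof -
  have sm: "summable (\<lambda>n. y ^ n)"
    by (rule summable_comparison_test'[of "\<lambda>n. norm y ^ n"])
      (use assms norm_power_ineq in \<open>auto simp: summable_geometric\<close>)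
  let ?s = "\<Sum>n. y ^ n"
  have "?s = 1 + (\<Sum>n. y ^ Suc n)"
    using suminf_split_head[OF sm] by simp
  moreover have "(\<Sum>n. y ^ Suc n) = y * ?s"
    using suminf_mult[OF sm, of y] by simp
  moreover have "(\<Sum>n. y ^ Suc n) = ?s * y"
    using suminf_mult2[OF sm, of y] by (simp add: power_commutes)
  ultimately have "(1 - y) * ?s = 1" "?s * (1 - y) = 1"
    by (simp_all add: algebra_simps)
  then show ?thesis
    by (auto simp: invertible_elem_def)
qed

lemma spectrum_norm_le:
  fixes y :: "'a::unital_cstar_algebra"
  assumes "z \<in> spectrum_of y"
  shows "cmod z \<le> norm y"
proof (rule ccontr)
  assume "\<not> cmod z \<le> norm y"
  then have z: "norm y < cmod z" "z \<noteq> 0"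
    by auto
  then have "norm (inverse z *\<^sub>c y) < 1"
    by (simp add: norm_cscale norm_divide inverse_eq_divide divide_less_eq)
  then have "invertible_elem ((- z) *\<^sub>c (1 - inverse z *\<^sub>c y))"
    using invertible_elem_one_minus z invertible_elem_cscale[of "- z"] by auto
  moreover have "(- z) *\<^sub>c (1 - inverse z *\<^sub>c y) = y - z *\<^sub>c 1"
    using z by (simp add: cscale_diff_right cscale_cscale cscale_minus_left)
  ultimately show False
    using assms by (simp add: spectrum_of_iff)
qed

text \<open>If \<open>a + \<i>b\<close> lies in the spectrum of \<open>x\<close>, then \<open>\<i>(b + s)\<close> lies in the spectrum of
  \<open>x - a + \<i>s\<close>, whose squared norm is at most \<open>\<parallel>x - a\<parallel>\<^sup>2 + s\<^sup>2\<close> by the C*-identity. For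
  large \<open>s\<close> of the sign of \<open>b\<close> this contradicts \<open>(b + s)\<^sup>2 = b\<^sup>2 + 2bs + s\<^sup>2\<close>.\<close>

lemma spectrum_self_adjoint_real:
  fixes x :: "'a::unital_cstar_algebra"
  assumes "self_adjoint x" and z: "z \<in> spectrum_of x"
  shows "Im z = 0"
proof (rule ccontr)
  assume b: "Im z \<noteq> 0"
  let ?u = "x - complex_of_real (Re z) *\<^sub>c 1"
  have star_u: "star ?u = ?u"
    using assms(1) by (simp add: self_adjoint_def star_diff star_cscale)
  have bound: "(Im z + s)\<^sup>2 \<le> (norm ?u)\<^sup>2 + s\<^sup>2" for s
  proof -
    let ?y = "?u + (\<i> * complex_of_real s) *\<^sub>c 1"
    have "?y - (\<i> * complex_of_real (Im z + s)) *\<^sub>c 1 = x - z *\<^sub>c 1"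
    proof -
      have "z = complex_of_real (Re z) + (\<i> * complex_of_real (Im z + s) - \<i> * complex_of_real s)"
        by (simp add: complex_eq_iff)
      then have "z *\<^sub>c 1 = complex_of_real (Re z) *\<^sub>c 1 +
          ((\<i> * complex_of_real (Im z + s)) *\<^sub>c 1 - (\<i> * complex_of_real s) *\<^sub>c (1::'a))"
        by (metis cscale_add_left cscale_diff_left)
      then show ?thesis
        by (simp add: algebra_simps)
    qed
    then have "\<i> * complex_of_real (Im z + s) \<in> spectrum_of ?y"
      using z by (metis spectrum_of_iff)
    then have "\<bar>Im z + s\<bar> \<le> norm ?y"
      using spectrum_norm_le by (fastforce simp: norm_mult simp flip: of_real_add)
    then have "(Im z + s)\<^sup>2 \<le> (norm ?y)\<^sup>2"
      by (metis abs_ge_zero power2_abs power_mono)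
    also have "\<dots> = norm (star ?y * ?y)"
      by (simp add: cstar_identity)
    also have "star ?y = ?u - (\<i> * complex_of_real s) *\<^sub>c 1"
      using star_u by (simp add: star_add star_cscale cscale_minus_left)
    also have "(?u - (\<i> * complex_of_real s) *\<^sub>c 1) * ?y = ?u * ?u + (s\<^sup>2) *\<^sub>R 1"
    proof -
      let ?c = "(\<i> * complex_of_real s) *\<^sub>c (1::'a)"
      have "(\<i> * complex_of_real s) * (\<i> * complex_of_real s) = complex_of_real (- (s\<^sup>2))"
        by (simp add: power2_eq_square algebra_simps)
      then have cc: "?c * ?c = - ((s\<^sup>2) *\<^sub>R 1)"
        by (simp only: cscale_mult_left cscale_mult_right cscale_cscale cscale_of_real) simp
      have comm: "?c * ?u = ?u * ?c"
        by (simp add: cscale_mult_left cscale_mult_right)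
      have "(u - c) * (u + c) = u * u - c * c" if "c * u = u * c" for u c :: 'a
        using that by (simp add: algebra_simps)
      from this[OF comm] show ?thesis
        unfolding cc by simp
    qed
    also have "norm \<dots> \<le> (norm ?u)\<^sup>2 + s\<^sup>2"
      using norm_triangle_ineq[of "?u * ?u" "(s\<^sup>2) *\<^sub>R 1"] norm_mult_ineq[of ?u ?u]
      by (simp add: power2_eq_square)
    finally show ?thesis .
  qed
  define s where "s = ((norm ?u)\<^sup>2 + 1) / (2 * Im z)"
  have "2 * Im z * s = (norm ?u)\<^sup>2 + 1"
    using b by (simp add: s_def)
  with bound[of s] have "(Im z)\<^sup>2 + 1 \<le> 0"
    by (simp add: power2_sum)
  then show False
    by (smt (verit) zero_le_power2)
qed

text \<open>By the fundamental theorem of algebra \<open>p(x)\<close> is a nonzero scalar times a product of factors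
  \<open>x - z\<close>, one for each root \<open>z\<close> of \<open>p\<close>, and each of them is invertible.\<close>

lemma poly_eval_invertible:
  fixes x :: "'a::unital_cstar_algebra"
  assumes "p \<noteq> 0" and "\<And>z. poly p z = 0 \<Longrightarrow> z \<notin> spectrum_of x"
  shows "invertible_elem (poly_eval p x)"
  using assms
proof (induction "degree p" arbitrary: p)
  case 0
  then obtain a where p: "p = [:a:]" "a \<noteq> 0"
    by (metis degree_eq_zeroE pCons_0_0)
  have "invertible_elem (1::'a)"
    by (auto simp: invertible_elem_def)
  with p show ?case
    by (simp add: invertible_elem_cscale)
next
  case (Suc n)
  then have "\<not> constant (poly p)"
    by (simp add: constant_degree)
  then obtain z where z: "poly p z = 0"
    using fundamental_theorem_of_algebra by blast
  then obtain q where q: "p = [:- z, 1:] * q"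
    by (auto simp: poly_eq_0_iff_dvd)
  then have "q \<noteq> 0"
    using Suc.prems by auto
  then have "degree p = Suc (degree q)"
    unfolding q by (subst degree_mult_eq) auto
  then have "invertible_elem (poly_eval q x)"
    using Suc \<open>q \<noteq> 0\<close> q by auto
  moreover have "invertible_elem (poly_eval [:- z, 1:] x)"
    using Suc.prems(2)[OF z] by (simp add: spectrum_of_iff cscale_minus_left)
  ultimately show ?case
    unfolding q poly_eval_mult by (metis invertible_elem_mult)
qed

text \<open>\<open>p - p(z)\<close> is a multiple of \<open>X - z\<close>, so an inverse of \<open>p(x) - p(z)\<close> yields a left and a right
  inverse of \<open>x - z\<close>. These coincide.\<close>

lemma poly_in_spectrum_poly_eval:
  fixes x :: "'a::unital_cstar_algebra"
  assumes "z \<in> spectrum_of x"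
  shows "poly p z \<in> spectrum_of (poly_eval p x)"
proof -
  obtain q where q: "p - [:poly p z:] = [:- z, 1:] * q"
    using poly_eq_0_iff_dvd[of "p - [:poly p z:]" z] by auto
  have eq: "poly_eval p x - poly p z *\<^sub>c 1 = poly_eval ([:- z, 1:] * q) x"
    unfolding q[symmetric] poly_eval_diff by simp
  show ?thesis
  proof (rule ccontr)
    assume "poly p z \<notin> spectrum_of (poly_eval p x)"
    then obtain w where "poly_eval ([:- z, 1:] * q) x * w = 1" "w * poly_eval ([:- z, 1:] * q) x = 1"
      unfolding spectrum_of_iff invertible_elem_def eq by auto
    then have w: "(x - z *\<^sub>c 1) * (poly_eval q x * w) = 1"
      "(w * poly_eval q x) * (x - z *\<^sub>c 1) = 1"
      using poly_eval_mult[of "[:- z, 1:]" q x] poly_eval_mult[of q "[:- z, 1:]" x]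
      by (simp_all only: mult.commute[of q] mult.assoc)
        (simp_all add: cscale_minus_left mult.assoc)
    then have "poly_eval q x * w = w * poly_eval q x"
      by (metis mult.assoc mult.left_neutral mult.right_neutral)
    with w show False
      using assms by (auto simp: spectrum_of_iff invertible_elem_def)
  qed
qed

text \<open>The nontrivial half of the spectral mapping theorem. A nonempty spectrum is assumed because a constant
  \<open>p\<close> would otherwise be a counterexample.\<close>

lemma spectrum_poly_eval_subset:
  fixes x :: "'a::unital_cstar_algebra"
  assumes "l \<in> spectrum_of (poly_eval p x)" and ne: "spectrum_of x \<noteq> {}"
  shows "\<exists>z\<in>spectrum_of x. poly p z = l"
proof (rule ccontr)
  assume *: "\<not> ?thesis"
  let ?q = "p - [:l:]"
  obtain z where "z \<in> spectrum_of x"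
    using ne by auto
  with * have "poly ?q z \<noteq> 0"
    by auto
  then have "?q \<noteq> 0"
    by (metis poly_0)
  then have "invertible_elem (poly_eval ?q x)"
    by (rule poly_eval_invertible) (use * in auto)
  then show False
    using assms(1) by (simp add: spectrum_of_iff poly_eval_diff)
qed


subsection \<open>The spectral radius of a self-adjoint element\<close>

text \<open>The C*-identity for a self-adjoint element reads \<open>\<parallel>h\<^sup>2\<parallel> = \<parallel>h\<parallel>\<^sup>2\<close>; it is iterated here.\<close>

lemma norm_power_self_adjoint:
  fixes h :: "'a::unital_cstar_algebra"
  assumes "self_adjoint h"
  shows "norm (h ^ (2 ^ n)) = norm h ^ (2 ^ n)"
proof (induction n)
  case (Suc n)
  have "norm (h ^ 2 ^ Suc n) = norm (star (h ^ 2 ^ n) * h ^ 2 ^ n)"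
    using assms by (simp add: star_power self_adjoint_def power_add mult_2)
  also have "\<dots> = (norm h ^ 2 ^ n)\<^sup>2"
    by (simp add: cstar_identity Suc)
  finally show ?case
    by (simp add: power_mult[symmetric] mult.commute)
qed simp

text \<open>With \<open>\<zeta>\<close> a root of \<open>\<zeta>\<^sup>m = -1\<close> for \<open>m = 2\<^sup>n\<close>, the inverse of \<open>1 - (wh)\<^bsup>2m\<^esup>\<close> is the average
  of those of \<open>1 - (wh)\<^sup>m\<close> and \<open>1 - (\<zeta>wh)\<^sup>m\<close>. Averages inherit a bound that is uniform over the unit
  circle, so the modulus of continuity of the resolvent serves for all these inverses at once.\<close>

lemma averaged_inverses:
  fixes h :: "'a::unital_cstar_algebra"
  assumes inv: "\<And>w. cmod w \<le> 1 \<Longrightarrow> (1 - w *\<^sub>c h) * S w = 1 \<and> S w * (1 - w *\<^sub>c h) = 1"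
    and close: "\<And>w. cmod w = 1 \<Longrightarrow> norm (S w - S (complex_of_real r * w)) \<le> e"
    and r: "0 \<le> r" "r \<le> 1"
  shows "\<exists>S. (\<forall>w. cmod w \<le> 1 \<longrightarrow> (1 - w ^ 2 ^ n *\<^sub>c h ^ 2 ^ n) * S w = 1
                                  \<and> S w * (1 - w ^ 2 ^ n *\<^sub>c h ^ 2 ^ n) = 1)
           \<and> (\<forall>w. cmod w = 1 \<longrightarrow> norm (S w - S (complex_of_real r * w)) \<le> e)"
proof (induction n)
  case 0
  show ?case
    using inv close by auto
next
  case (Suc n)
  then obtain S where S: "\<And>w. cmod w \<le> 1 \<Longrightarrow> (1 - w ^ 2 ^ n *\<^sub>c h ^ 2 ^ n) * S w = 1"
      "\<And>w. cmod w \<le> 1 \<Longrightarrow> S w * (1 - w ^ 2 ^ n *\<^sub>c h ^ 2 ^ n) = 1"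
    and cl: "\<And>w. cmod w = 1 \<Longrightarrow> norm (S w - S (complex_of_real r * w)) \<le> e"
    by blast
  define \<zeta> where "\<zeta> = cis (pi / 2 ^ n)"
  have \<zeta>: "\<zeta> ^ 2 ^ n = - 1" "cmod \<zeta> = 1"
    by (simp_all add: \<zeta>_def Complex.DeMoivre)
  define T where "T w = (1 / 2) *\<^sub>R (S w + S (\<zeta> * w))" for w
  have T: "(1 - w ^ 2 ^ Suc n *\<^sub>c h ^ 2 ^ Suc n) * T w = 1
         \<and> T w * (1 - w ^ 2 ^ Suc n *\<^sub>c h ^ 2 ^ Suc n) = 1" if w: "cmod w \<le> 1" for w
  proof -
    define u where "u = w ^ 2 ^ n *\<^sub>c h ^ 2 ^ n"
    have w': "cmod (\<zeta> * w) \<le> 1"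
      using w \<zeta> by (simp add: norm_mult)
    have "(\<zeta> * w) ^ 2 ^ n *\<^sub>c h ^ 2 ^ n = - u"
      by (simp add: power_mult_distrib \<zeta> u_def cscale_minus_left)
    with S(1)[OF w'] S(2)[OF w'] have s': "(1 + u) * S (\<zeta> * w) = 1" "S (\<zeta> * w) * (1 + u) = 1"
      by simp_all
    have s: "(1 - u) * S w = 1" "S w * (1 - u) = 1"
      using S w by (simp_all add: u_def)
    have uu: "w ^ 2 ^ Suc n *\<^sub>c h ^ 2 ^ Suc n = u * u"
      by (simp add: u_def cscale_mult_left cscale_mult_right cscale_cscale power_add mult_2)
    have f: "1 - u * u = (1 + u) * (1 - u)" "1 - u * u = (1 - u) * (1 + u)"
      by (simp_all add: algebra_simps)
    have "(1 - u * u) * S w = 1 + u" "S w * (1 - u * u) = 1 + u"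
      using s by (metis f mult.assoc mult.right_neutral mult.left_neutral)+
    moreover have "(1 - u * u) * S (\<zeta> * w) = 1 - u" "S (\<zeta> * w) * (1 - u * u) = 1 - u"
      using s' by (metis f mult.assoc mult.right_neutral mult.left_neutral)+
    moreover have "1 + u + (1 - u) = 1 + 1"
      by simp
    then have "(1 / 2) *\<^sub>R (1 + u + (1 - u)) = 1"
      by (metis scaleR_half_double)
    ultimately show ?thesis
      unfolding uu T_def
      by (simp only: mult_scaleR_left mult_scaleR_right distrib_left distrib_right)
  qed
  have "norm (T w - T (complex_of_real r * w)) \<le> e" if w: "cmod w = 1" for w
  proof -
    let ?a = "S w - S (complex_of_real r * w)"
    let ?b = "S (\<zeta> * w) - S (complex_of_real r * (\<zeta> * w))"
    have "T w - T (complex_of_real r * w) = (1 / 2) *\<^sub>R (?a + ?b)"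
      unfolding T_def by (simp add: algebra_simps)
    moreover have "norm ?a \<le> e"
      using cl w by blast
    moreover have "norm ?b \<le> e"
      using cl[of "\<zeta> * w"] w \<zeta> by (simp add: norm_mult)
    ultimately show ?thesis
      using norm_triangle_ineq[of ?a ?b] by simp
  qed
  with T show ?case
    by blast
qed

text \<open>The resolvent identity bounds \<open>S w - S v\<close> by \<open>\<parallel>S w\<parallel> \<bar>w - v\<bar> \<parallel>S v\<parallel>\<close>. For \<open>w\<close> near \<open>v\<close> the
  same bound limits \<open>\<parallel>S w\<parallel>\<close> itself, so that it can be eliminated.\<close>

lemma continuous_on_inverses:
  fixes h :: "'a::unital_cstar_algebra"
  assumes inv: "\<And>w. w \<in> D \<Longrightarrow> (1 - w *\<^sub>c h) * S w = 1 \<and> S w * (1 - w *\<^sub>c h) = 1"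
    and h: "norm h = 1"
  shows "continuous_on D S"
proof (rule continuous_onI)
  fix v e assume v: "v \<in> D" and e: "(0::real) < e"
  define M where "M = norm (S v) + 1"
  have M: "M > 0" "norm (S v) \<le> M"
    by (auto simp: M_def add_nonneg_pos)
  \<comment> \<open>The first entry keeps \<open>\<parallel>S w\<parallel>\<close> below \<open>2 * M\<close>; the second then gives the estimate \<open>e\<close>.\<close>
  define d where "d = min (1 / (2 * M)) (e / (4 * M * M))"
  have "d > 0"
    using M e by (auto simp: d_def)
  moreover have "dist (S w) (S v) \<le> e" if w: "w \<in> D" "dist w v < d" for w
  proof -
    have i: "S w * (1 - w *\<^sub>c h) = 1" "(1 - v *\<^sub>c h) * S v = 1"
      using inv v w by blast+
    have "S w - S v = S w * ((1 - v *\<^sub>c h) * S v) - (S w * (1 - w *\<^sub>c h)) * S v"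
      unfolding i by (simp only: mult_1_left mult_1_right)
    also have "\<dots> = S w * ((1 - v *\<^sub>c h) - (1 - w *\<^sub>c h)) * S v"
      by (simp only: left_diff_distrib right_diff_distrib mult.assoc)
    also have "\<dots> = S w * ((w - v) *\<^sub>c h) * S v"
      by (simp add: cscale_diff_left)
    finally have "norm (S w - S v) = norm (S w * ((w - v) *\<^sub>c h) * S v)"
      by (rule arg_cong)
    also have "\<dots> \<le> norm (S w * ((w - v) *\<^sub>c h)) * norm (S v)"
      by (rule norm_mult_ineq)
    also have "\<dots> \<le> norm (S w) * norm ((w - v) *\<^sub>c h) * norm (S v)"
      by (intro mult_right_mono norm_mult_ineq norm_ge_zero)
    also have "\<dots> = norm (S w) * (cmod (w - v) * norm (S v))"
      using h by (simp add: norm_cscale)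
    also have "\<dots> \<le> norm (S w) * (d * M)"
      using w M \<open>d > 0\<close> by (intro mult_left_mono mult_mono) (auto simp: dist_norm)
    finally have b: "norm (S w - S v) \<le> norm (S w) * (d * M)" .
    have "d * M \<le> 1 / 2"
      using M by (simp add: d_def min_def field_simps)
    then have "norm (S w) * (d * M) \<le> norm (S w) * (1 / 2)"
      by (intro mult_left_mono) auto
    with b have "norm (S w) \<le> 2 * M"
      using norm_triangle_ineq2[of "S w" "S v"] M by simp
    then have "norm (S w) * (d * M) \<le> 2 * M * (e / (4 * M * M) * M)"
      using M \<open>d > 0\<close> by (intro mult_mono) (auto simp: d_def)
    with b M e show ?thesis
      by (simp add: dist_norm field_simps)
  qed
  ultimately show "\<exists>d>0. \<forall>w\<in>D. dist w v < d \<longrightarrow> dist (S w) (S v) \<le> e"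
    by blast
qed

text \<open>If neither \<open>1\<close> nor \<open>- 1\<close> were in the spectrum, then \<open>1 - wh\<close> would be invertible on the whole
  closed unit disc: inside by the Neumann series, and on the circle because the spectrum is real. By
  \<open>averaged_inverses\<close> the inverse of \<open>1 - h\<^sup>m\<close>, for \<open>m\<close> a power of two, would be as close to that
  of \<open>1 - (rh)\<^sup>m\<close> as the resolvents at \<open>w\<close> and \<open>rw\<close> are, uniformly in \<open>m\<close>. For \<open>r < 1\<close> the latter
  tends to \<open>1\<close>, and so \<open>h\<^sup>m\<close> would become small, although its norm is \<open>1\<close>.\<close>

lemma unit_norm_self_adjoint_spectrum:
  fixes h :: "'a::unital_cstar_algebra"
  assumes sa: "self_adjoint h" and h: "norm h = 1"
  shows "1 \<in> spectrum_of h \<or> - 1 \<in> spectrum_of h"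
proof (rule ccontr)
  assume no: "\<not> ?thesis"
  have real_unit: "v = 1 \<or> v = - 1" if "Im v = 0" "cmod v = 1" for v
    using that by (auto simp: cmod_eq_Re complex_eq_iff abs_if split: if_splits)
  have "invertible_elem (1 - w *\<^sub>c h)" if w: "cmod w \<le> 1" for w
  proof (cases "cmod w < 1")
    case True
    then show ?thesis
      using h by (intro invertible_elem_one_minus) (simp add: norm_cscale)
  next
    case False
    with w have w1: "cmod w = 1" "w \<noteq> 0"
      by auto
    have "inverse w \<notin> spectrum_of h"
    proof
      assume i: "inverse w \<in> spectrum_of h"
      then have "Im (inverse w) = 0"
        using spectrum_self_adjoint_real[OF sa] by blast
      moreover have "cmod (inverse w) = 1"
        using w1 by (simp add: norm_inverse)
      ultimately have "inverse w = 1 \<or> inverse w = - 1"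
        by (rule real_unit)
      with i no show False
        by auto
    qed
    then have "invertible_elem ((- w) *\<^sub>c (h - inverse w *\<^sub>c 1))"
      using w1 by (simp add: spectrum_of_iff invertible_elem_cscale)
    then show ?thesis
      using w1 by (simp add: cscale_diff_right cscale_cscale cscale_minus_left)
  qed
  then obtain R where R: "\<And>w. cmod w \<le> 1 \<Longrightarrow> (1 - w *\<^sub>c h) * R w = 1 \<and> R w * (1 - w *\<^sub>c h) = 1"
    unfolding invertible_elem_def by metis
  have "continuous_on (cball 0 1) R"
    by (rule continuous_on_inverses[OF R h]) auto
  then have "uniformly_continuous_on (cball 0 1) R"
    by (intro compact_uniformly_continuous) auto
  then obtain d where d: "d > 0"
    "\<And>v w. cmod v \<le> 1 \<Longrightarrow> cmod w \<le> 1 \<Longrightarrow> dist v w < d \<Longrightarrow> dist (R v) (R w) < 1 / 8"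
    unfolding uniformly_continuous_on_def
    by (metis mem_cball_0 zero_less_divide_1_iff zero_less_numeral)
  define r where "r = 1 - min (d / 2) (1 / 2)"
  have r: "0 \<le> r" "r < 1" "1 - r < d"
    using d by (auto simp: r_def min_def)
  have close: "norm (R w - R (complex_of_real r * w)) \<le> 1 / 8" if w: "cmod w = 1" for w
  proof -
    have "dist w (complex_of_real r * w) = cmod (complex_of_real (1 - r) * w)"
      by (simp add: dist_norm algebra_simps)
    also have "\<dots> < d"
      using r w by (simp add: norm_mult del: of_real_diff)
    finally show ?thesis
      using d(2)[of w "complex_of_real r * w"] w r by (simp add: norm_mult dist_norm)
  qed
  obtain n where n: "r ^ n < 1 / 8"
    using real_arch_pow_inv[of "1/8" r] r by auto
  have "r ^ 2 ^ n \<le> r ^ n"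
    using r by (intro power_decreasing) (auto intro: less_imp_le)
  with n have n: "r ^ 2 ^ n < 1 / 8"
    by simp
  obtain S where S: "\<And>w. cmod w \<le> 1 \<Longrightarrow> (1 - w ^ 2 ^ n *\<^sub>c h ^ 2 ^ n) * S w = 1
                                  \<and> S w * (1 - w ^ 2 ^ n *\<^sub>c h ^ 2 ^ n) = 1"
    and Sc: "\<And>w. cmod w = 1 \<Longrightarrow> norm (S w - S (complex_of_real r * w)) \<le> 1 / 8"
    using averaged_inverses[of h R r "1/8" n] R close r by auto
  \<comment> \<open>The inverses of \<open>1 - g\<close> and of \<open>1 - y\<close>, where \<open>y\<close> is the small multiple of \<open>g\<close> below.\<close>
  define A B g where "A = S 1" and "B = S (complex_of_real r)" and "g = h ^ 2 ^ n"
  have g: "norm g = 1"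
    using norm_power_self_adjoint[OF sa] h by (simp add: g_def)
  have A: "A * (1 - g) = 1"
    using S[of 1] by (simp add: A_def g_def)
  define y where "y = complex_of_real r ^ 2 ^ n *\<^sub>c g"
  have y: "norm y \<le> 1 / 8"
    using n r g by (simp add: y_def norm_cscale norm_power)
  have "(1 - y) * B = 1"
    using S[of "complex_of_real r"] r by (simp add: y_def g_def B_def)
  then have B1: "B - 1 = y * B"
    by (simp add: algebra_simps)
  then have nB: "norm (B - 1) \<le> 1 / 8 * norm B"
    using norm_mult_ineq[of y B] y by (smt (verit) mult_right_mono norm_ge_zero)
  then have "norm B \<le> 8 / 7"
    using norm_triangle_ineq2[of B 1] by simp
  moreover have "norm (A - B) \<le> 1 / 8"
    using Sc[of 1] by (simp add: A_def B_def)
  ultimately have A1: "norm (A - 1) < 1 / 3"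
    using nB norm_triangle_ineq[of "A - B" "B - 1"] by simp
  have "g = (A - 1) * (1 - g)"
    using A by (simp add: left_diff_distrib)
  then have "1 \<le> norm (A - 1) * norm (1 - g)"
    using g norm_mult_ineq[of "A - 1" "1 - g"] by simp
  also have "\<dots> \<le> 1 / 3 * 2"
    using A1 norm_triangle_ineq4[of 1 g] g by (intro mult_mono) auto
  finally show False
    by simp
qed

lemma self_adjoint_norm_in_spectrum:
  fixes h :: "'a::unital_cstar_algebra"
  assumes "self_adjoint h"
  shows "complex_of_real (norm h) \<in> spectrum_of h \<or> complex_of_real (- norm h) \<in> spectrum_of h"
proof (cases "h = 0")
  case True
  then show ?thesis
    by (simp add: spectrum_of_iff invertible_elem_def)
next
  case False
  define g where "g = inverse (norm h) *\<^sub>R h"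
  have "self_adjoint g" "norm g = 1"
    using assms False by (auto simp: g_def self_adjoint_def star_scaleR)
  then have "1 \<in> spectrum_of g \<or> - 1 \<in> spectrum_of g"
    by (rule unit_norm_self_adjoint_spectrum)
  moreover have "z * complex_of_real (norm h) \<in> spectrum_of h" if z: "z \<in> spectrum_of g" for z
  proof -
    have "h - (z * complex_of_real (norm h)) *\<^sub>c 1 = complex_of_real (norm h) *\<^sub>c (g - z *\<^sub>c 1)"
      using False by (simp add: g_def cscale_diff_right cscale_cscale cscale_of_real mult.commute)
    then show ?thesis
      using z False by (simp add: spectrum_of_iff invertible_elem_cscale)
  qed
  ultimately show ?thesis
    by fastforce
qed

lemma real_spectrum_nonempty:
  fixes x :: "'a::unital_cstar_algebra"
  assumes "self_adjoint x"
  shows "real_spectrum x \<noteq> {}"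
  using self_adjoint_norm_in_spectrum[OF assms] by (auto simp: real_spectrum_def simp del: of_real_minus)

lemma real_spectrum_abs_le:
  assumes "t \<in> real_spectrum x"
  shows "\<bar>t\<bar> \<le> norm x"
  using assms spectrum_norm_le[of "complex_of_real t" x] by (simp add: real_spectrum_def)

lemma poly_real_spectrum_le:
  assumes "t \<in> real_spectrum x"
  shows "cmod (poly p (complex_of_real t)) \<le> norm (poly_eval p x)"
  using assms spectrum_norm_le[OF poly_in_spectrum_poly_eval] by (simp add: real_spectrum_def)

text \<open>By the C*-identity \<open>\<parallel>p(x)\<parallel>\<^sup>2\<close> is the norm of the self-adjoint element \<open>(\<bar>p\<bar>\<^sup>2)(x)\<close>, so it is, up to
  a sign, a point of the spectrum of that element and hence a value of the polynomial \<open>\<bar>p\<bar>\<^sup>2\<close> on the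
  spectrum of \<open>x\<close>.\<close>

lemma poly_real_spectrum_attained:
  fixes x :: "'a::unital_cstar_algebra"
  assumes sa: "self_adjoint x"
  shows "\<exists>t\<in>real_spectrum x. cmod (poly p (complex_of_real t)) = norm (poly_eval p x)"
proof -
  define q where "q = map_poly cnj p * p"
  define h where "h = poly_eval q x"
  have h: "h = star (poly_eval p x) * poly_eval p x"
    by (simp add: h_def q_def poly_eval_mult poly_eval_map_cnj[OF sa])
  then have "self_adjoint h" "norm h = (norm (poly_eval p x))\<^sup>2"
    by (simp_all add: self_adjoint_def star_mult star_star cstar_identity)
  moreover have "cmod (complex_of_real (norm h)) = norm h" "cmod (complex_of_real (- norm h)) = norm h"
    by simp_all
  ultimately obtain l where l: "l \<in> spectrum_of h" "cmod l = (norm (poly_eval p x))\<^sup>2"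
    using self_adjoint_norm_in_spectrum[of h] by metis
  have "spectrum_of x \<noteq> {}"
    using real_spectrum_nonempty[OF sa] by (auto simp: real_spectrum_def)
  then obtain z where z: "z \<in> spectrum_of x" "poly q z = l"
    using spectrum_poly_eval_subset[of l q x] l by (auto simp: h_def)
  define t where "t = Re z"
  have "Im z = 0"
    using spectrum_self_adjoint_real[OF sa] z by blast
  then have zt: "z = complex_of_real t"
    by (metis complex_is_Real_iff of_real_Re t_def)
  have "cnj (poly p (complex_of_real t)) = poly (map_poly cnj p) (complex_of_real t)"
    by (metis poly_cnj complex_cnj_complex_of_real)
  then have "l = cnj (poly p (complex_of_real t)) * poly p (complex_of_real t)"
    using z by (simp add: q_def zt)
  then have "(cmod (poly p (complex_of_real t)))\<^sup>2 = (norm (poly_eval p x))\<^sup>2"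
    using l by (simp add: norm_mult power2_eq_square)
  then have "cmod (poly p (complex_of_real t)) = norm (poly_eval p x)"
    by (simp add: power2_eq_iff_nonneg)
  then show ?thesis
    using z zt by (auto simp: real_spectrum_def)
qed

section \<open>Self-adjoint matrices\<close>

lemma mat_adjoint_carrier [simp, intro]:
  "A \<in> carrier_mat n m \<Longrightarrow> mat_adjoint A \<in> carrier_mat m n"
  by (auto simp: mat_adjoint_def mat_of_rows_def)

lemma mat_adjoint_dim [simp]:
  "dim_row (mat_adjoint A) = dim_col A" "dim_col (mat_adjoint A) = dim_row A"
  by (auto simp: mat_adjoint_def mat_of_rows_def)

lemma mat_adjoint_index [simp]:
  fixes A :: "complex mat"
  shows "i < dim_col A \<Longrightarrow> j < dim_row A \<Longrightarrow> mat_adjoint A $$ (i, j) = cnj (A $$ (j, i))"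
  by (simp add: mat_adjoint_def mat_of_rows_def)

lemma mat_adjoint_adjoint [simp]: "mat_adjoint (mat_adjoint (A :: complex mat)) = A"
  by (rule eq_matI) auto

lemma mat_adjoint_mult:
  fixes A B :: "complex mat"
  assumes "A \<in> carrier_mat n m" "B \<in> carrier_mat m p"
  shows "mat_adjoint (A * B) = mat_adjoint B * mat_adjoint A"
  by (rule eq_matI) (use assms in \<open>auto simp: scalar_prod_def mult.commute\<close>)

lemma is_unitaryD:
  assumes "is_unitary k W"
  shows "W \<in> carrier_mat k k" "W * mat_adjoint W = 1\<^sub>m k" "mat_adjoint W * W = 1\<^sub>m k"
  using assms by (auto simp: is_unitary_def)

lemma is_unitaryI:
  fixes W :: "complex mat"
  assumes "W \<in> carrier_mat k k" "W * mat_adjoint W = 1\<^sub>m k"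
  shows "is_unitary k W"
  using assms mat_mult_left_right_inverse[of W k "mat_adjoint W"] by (auto simp: is_unitary_def)

lemma is_unitary_adjoint: "is_unitary k W \<Longrightarrow> is_unitary k (mat_adjoint W)"
  by (auto simp: is_unitary_def)

lemma is_unitary_mult:
  assumes "is_unitary k V" "is_unitary k W"
  shows "is_unitary k (V * W)"
proof (rule is_unitaryI)
  note V = is_unitaryD[OF assms(1)] and W = is_unitaryD[OF assms(2)]
  show "V * W \<in> carrier_mat k k"
    using V W by auto
  have "V * W * mat_adjoint (V * W) = V * (W * mat_adjoint W) * mat_adjoint V"
    using V(1) W(1) by (simp add: mat_adjoint_mult[of _ k k _ k] assoc_mult_mat[of _ k k _ k _ k] mult_carrier_mat[of _ k k _ k])
  then show "V * W * mat_adjoint (V * W) = 1\<^sub>m k"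
    using V W by simp
qed

subsection \<open>Unitarily diagonalised matrices\<close>

definition udiag :: "nat \<Rightarrow> complex mat \<Rightarrow> (nat \<Rightarrow> complex) \<Rightarrow> complex mat"
  where "udiag k U d = U * mat_diag k d * mat_adjoint U"

lemma udiag_carrier [simp, intro]: "U \<in> carrier_mat k k \<Longrightarrow> udiag k U d \<in> carrier_mat k k"
  by (auto simp: udiag_def intro!: mult_carrier_mat)

lemma udiag_dim [simp]: "dim_row (udiag k U d) = dim_row U" "dim_col (udiag k U d) = dim_row U"
  by (simp_all add: udiag_def)

lemma udiag_index:
  assumes "U \<in> carrier_mat k k" "i < k" "j < k"
  shows "udiag k U d $$ (i, j) = (\<Sum>l<k. U $$ (i, l) * d l * cnj (U $$ (j, l)))"
proof -
  have "U * mat_diag k d = Matrix.mat k k (\<lambda>(i, j). U $$ (i, j) * d j)"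
    using assms by (simp add: mat_diag_mult_right)
  then show ?thesis
    using assms by (simp add: udiag_def scalar_prod_def lessThan_atLeast0)
qed

lemma udiag_const_one: "U \<in> carrier_mat k k \<Longrightarrow> udiag k U (\<lambda>_. 1) = U * mat_adjoint U"
  by (simp add: udiag_def)

lemma udiag_one_left:
  "mat_diag k d = udiag k (1\<^sub>m k) d"
proof -
  have "mat_adjoint (1\<^sub>m k) = (1\<^sub>m k :: complex mat)"
    by (rule eq_matI) auto
  then show ?thesis
    by (simp add: udiag_def) (metis left_mult_one_mat mat_diag_dim right_mult_one_mat)
qed

lemma is_unitary_one: "is_unitary k (1\<^sub>m k)"
  using udiag_one_left[of k "\<lambda>_. 1"] by (intro is_unitaryI) (auto simp: udiag_const_one)

lemma udiag_minus:
  assumes "U \<in> carrier_mat k k"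
  shows "udiag k U d - udiag k U e = udiag k U (\<lambda>i. d i - e i)"
  by (rule eq_matI)
    (use assms in \<open>auto simp: udiag_index algebra_simps sum_subtractf\<close>)

lemma udiag_adjoint:
  assumes "U \<in> carrier_mat k k"
  shows "mat_adjoint (udiag k U d) = udiag k U (\<lambda>i. cnj (d i))"
  by (rule eq_matI)
    (use assms in \<open>auto simp: udiag_index algebra_simps\<close>)

lemma udiag_mult:
  assumes "is_unitary k U"
  shows "udiag k U d * udiag k U e = udiag k U (\<lambda>i. d i * e i)"
proof -
  note U = is_unitaryD[OF assms]
  have "udiag k U d * udiag k U e =
      U * mat_diag k d * (mat_adjoint U * U) * (mat_diag k e * mat_adjoint U)"
    unfolding udiag_def using U(1) by (simp add: assoc_mult_mat[of _ k k _ k _ k] mult_carrier_mat[of _ k k _ k])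
  also have "\<dots> = U * (mat_diag k d * mat_diag k e) * mat_adjoint U"
    unfolding U(3) using U(1) by (simp add: left_mult_one_mat[of _ k k] assoc_mult_mat[of _ k k _ k _ k] mult_carrier_mat[of _ k k _ k] del: mat_diag_diag)
  finally show ?thesis
    by (simp add: udiag_def)
qed

lemma udiag_conjugate:
  assumes "W \<in> carrier_mat k k" "U \<in> carrier_mat k k"
  shows "W * udiag k U d * mat_adjoint W = udiag k (W * U) d"
  using assms
  by (simp add: udiag_def mat_adjoint_mult[of _ k k _ k] assoc_mult_mat[of _ k k _ k _ k] mult_carrier_mat[of _ k k _ k])

lemma udiag_power:
  assumes "is_unitary k U"
  shows "udiag k U d ^\<^sub>m n = udiag k U (\<lambda>i. d i ^ n)"
proof (induction n)
  case 0
  then show ?case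
    using is_unitaryD[OF assms] by (simp add: udiag_const_one)
next
  case (Suc n)
  then show ?case
    using udiag_mult[OF assms, of "\<lambda>i. d i ^ n" d] by (simp add: mult.commute)
qed

lemma mat_poly_eval_udiag:
  assumes "is_unitary k U"
  shows "mat_poly_eval k p (udiag k U d) = udiag k U (\<lambda>i. poly p (d i))"
proof (rule eq_matI)
  note U = is_unitaryD[OF assms]
  fix i j assume "i < dim_row (udiag k U (\<lambda>i. poly p (d i)))" "j < dim_col (udiag k U (\<lambda>i. poly p (d i)))"
  then have ij: "i < k" "j < k"
    using U(1) by auto
  have "mat_poly_eval k p (udiag k U d) $$ (i, j) =
      (\<Sum>n\<le>degree p. \<Sum>l<k. coeff p n * (U $$ (i, l) * d l ^ n * cnj (U $$ (j, l))))"
    using ij U by (simp add: mat_poly_eval_def udiag_power[OF assms] udiag_index sum_distrib_left)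
  also have "\<dots> = (\<Sum>l<k. \<Sum>n\<le>degree p. U $$ (i, l) * (coeff p n * d l ^ n) * cnj (U $$ (j, l)))"
    by (subst sum.swap) (simp add: algebra_simps)
  also have "\<dots> = udiag k U (\<lambda>i. poly p (d i)) $$ (i, j)"
    using ij U by (simp add: udiag_index poly_altdef sum_distrib_left sum_distrib_right)
  finally show "mat_poly_eval k p (udiag k U d) $$ (i, j) = udiag k U (\<lambda>i. poly p (d i)) $$ (i, j)" .
qed (use is_unitaryD(1)[OF assms] in \<open>auto simp: mat_poly_eval_def\<close>)

subsection \<open>The spectral theorem\<close>

lemma cscalar_prod_vec_l2_norm: "v \<bullet>c v = complex_of_real ((vec_l2_norm v)\<^sup>2)"
  by (simp add: vec_l2_norm_def scalar_prod_def sum_nonneg lessThan_atLeast0 complex_norm_square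
      del: of_real_power)

text \<open>Complete \<open>v\<close> to a basis, orthogonalise it by Gram-Schmidt, and normalise the resulting columns.\<close>

lemma exists_unitary_first_col:
  fixes v :: "complex vec"
  assumes v: "v \<in> carrier_vec n" "v \<noteq> 0\<^sub>v n"
  shows "\<exists>W c. is_unitary n W \<and> c \<noteq> 0 \<and> col W 0 = c \<cdot>\<^sub>v v"
proof -
  interpret cof_vec_space n "TYPE(complex)" .
  define b where "b = basis_completion v"
  from basis_completion[OF v, folded b_def]
  have b: "distinct b" "\<not> lin_dep (set b)" "set b \<subseteq> carrier_vec n" "hd b = v" "length b = n"
    by auto
  have n: "0 < n"
    using v by (cases n) auto
  then obtain vs where bv: "b = v # vs"
    using b by (cases b) auto
  define ws where "ws = gram_schmidt n b"
  have ws: "set ws \<subseteq> carrier_vec n" "corthogonal ws" "length ws = n"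
    using gram_schmidt_result[OF b(3,1,2) refl, folded ws_def] b by auto
  have "hd ws = v"
    using gram_schmidt_hd[OF v(1), of vs, folded bv] by (simp add: ws_def)
  then have ws0: "ws ! 0 = v"
    using ws(3) n by (metis hd_conv_nth length_0_conv not_less_zero)
  define N where "N j = vec_l2_norm (ws ! j)" for j
  have wsc: "ws ! j \<in> carrier_vec n" if "j < n" for j
    using ws that by (metis nth_mem subsetD)
  have N: "(complex_of_real (N j))\<^sup>2 = ws ! j \<bullet>c ws ! j" "N j \<noteq> 0" if "j < n" for j
  proof -
    show *: "(complex_of_real (N j))\<^sup>2 = ws ! j \<bullet>c ws ! j"
      by (simp add: N_def cscalar_prod_vec_l2_norm)
    have "ws ! j \<bullet>c ws ! j \<noteq> 0"
      using corthogonalD[OF ws(2)] that ws by simp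
    with * show "N j \<noteq> 0"
      by auto
  qed
  define W where "W = Matrix.mat n n (\<lambda>(i, j). ws ! j $ i / complex_of_real (N j))"
  have W: "W \<in> carrier_mat n n"
    by (simp add: W_def)
  have "mat_adjoint W * W = 1\<^sub>m n"
  proof (rule eq_matI)
    fix i j assume "i < dim_row (1\<^sub>m n)" "j < dim_col (1\<^sub>m n)"
    then have ij: "i < n" "j < n"
      by auto
    have "(mat_adjoint W * W) $$ (i, j) =
        (\<Sum>l<n. ws ! j $ l * cnj (ws ! i $ l)) / (complex_of_real (N i) * complex_of_real (N j))"
      using ij W
      by (simp add: scalar_prod_def lessThan_atLeast0 W_def sum_divide_distrib algebra_simps)
    also have "(\<Sum>l<n. ws ! j $ l * cnj (ws ! i $ l)) = ws ! j \<bullet>c ws ! i"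
      using wsc[OF ij(1)] by (simp add: scalar_prod_def lessThan_atLeast0)
    also have "\<dots> / (complex_of_real (N i) * complex_of_real (N j)) = 1\<^sub>m n $$ (i, j)"
    proof (cases "i = j")
      case True
      then show ?thesis
        using N[OF ij(1)] ij by (simp flip: N(1) add: power2_eq_square)
    next
      case False
      then show ?thesis
        using corthogonalD[OF ws(2), of j i] ij ws by simp
    qed
    finally show "(mat_adjoint W * W) $$ (i, j) = 1\<^sub>m n $$ (i, j)" .
  qed (use W in auto)
  then have "is_unitary n (mat_adjoint W)"
    using W by (intro is_unitaryI) auto
  then have "is_unitary n W"
    using is_unitary_adjoint by fastforce
  moreover have "col W 0 = (1 / complex_of_real (N 0)) \<cdot>\<^sub>v v"
    by (rule eq_vecI) (use n v ws0 in \<open>auto simp: W_def\<close>)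
  ultimately show ?thesis
    using N(2)[OF n] by (intro exI[of _ W] exI[of _ "1 / complex_of_real (N 0)"]) auto
qed

text \<open>Induction on the size. In an orthonormal basis that starts with an eigenvector the first column of the
  matrix is that of a diagonal matrix. By symmetry so is the first row, and the induction hypothesis
  applies to the remaining block.\<close>

lemma hermitian_diagonalisation:
  assumes "A \<in> carrier_mat k k" "mat_adjoint A = A"
  shows "\<exists>U a. is_unitary k U \<and> A = udiag k U (\<lambda>i. complex_of_real (a i))"
  using assms
proof (induction k arbitrary: A)
  case 0
  have "is_unitary 0 (1\<^sub>m 0)"
    by (rule is_unitaryI) auto
  moreover have "A = udiag 0 (1\<^sub>m 0) (\<lambda>i. complex_of_real 0)"
    using 0 by (intro eq_matI) (auto simp: udiag_def)
  ultimately show ?case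
    by fast
next
  case (Suc n)
  let ?k = "Suc n"
  note A = Suc.prems
  obtain as where as: "char_poly A = (\<Prod>a\<leftarrow>as. [:- a, 1:])" "length as = ?k"
    using char_poly_factorized[OF A(1)] by blast
  then obtain e es where "as = e # es"
    by (cases as) auto
  with as have "poly (char_poly A) e = 0"
    by simp
  then obtain v where v: "v \<in> carrier_vec ?k" "v \<noteq> 0\<^sub>v ?k" "A *\<^sub>v v = e \<cdot>\<^sub>v v"
    using eigenvalue_root_char_poly[OF A(1)] A(1) by (auto simp: eigenvalue_def eigenvector_def)
  obtain W c where W: "is_unitary ?k W" and c: "c \<noteq> 0" "col W 0 = c \<cdot>\<^sub>v v"
    using exists_unitary_first_col[OF v(1,2)] by blast
  note W' = is_unitaryD[OF W]
  define B where "B = mat_adjoint W * (A * W)"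
  have B: "B \<in> carrier_mat ?k ?k"
    using W' A by (auto simp: B_def)
  have B_adj: "mat_adjoint B = B"
    using W' A by (simp add: B_def mat_adjoint_mult[of _ ?k ?k _ ?k] assoc_mult_mat[of _ ?k ?k _ ?k _ ?k]
          mult_carrier_mat[of _ ?k ?k _ ?k])
  have WB: "W * B * mat_adjoint W = A"
  proof -
    have "W * B * mat_adjoint W = (W * mat_adjoint W) * A * (W * mat_adjoint W)"
      using W'(1) A by (simp add: B_def assoc_mult_mat[of _ ?k ?k _ ?k _ ?k]
          mult_carrier_mat[of _ ?k ?k _ ?k])
    then show ?thesis
      using W' A by simp
  qed
  have "col (A * W) 0 = A *\<^sub>v col W 0"
    using A W' by (intro eq_vecI) auto
  also have "\<dots> = e \<cdot>\<^sub>v col W 0"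
    using v A by (simp add: c mult_mat_vec[of _ ?k ?k] smult_smult_assoc mult.commute)
  finally have AW: "col (A * W) 0 = e \<cdot>\<^sub>v col W 0" .
  have B0: "B $$ (i, 0) = (if i = 0 then e else 0)" if "i < ?k" for i
  proof -
    have "B $$ (i, 0) = row (mat_adjoint W) i \<bullet> col (A * W) 0"
      using that W' A by (simp add: B_def)
    also have "\<dots> = e * (row (mat_adjoint W) i \<bullet> col W 0)"
      using that W' by (simp add: AW scalar_prod_smult_distrib[of _ ?k])
    also have "row (mat_adjoint W) i \<bullet> col W 0 = (mat_adjoint W * W) $$ (i, 0)"
      using that W'(1) by simp
    finally show ?thesis
      using that W' by simp
  qed
  have Bsym: "B $$ (i, j) = cnj (B $$ (j, i))" if "i < ?k" "j < ?k" for i j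
    using that B arg_cong[OF B_adj, of "\<lambda>M. M $$ (i, j)"] by simp
  have cnj_e: "cnj e = e"
    by (metis Bsym B0 zero_less_Suc)
  then have e_real: "complex_of_real (Re e) = e"
    by (metis Reals_cnj_iff of_real_Re)
  define C where "C = Matrix.mat n n (\<lambda>(i, j). B $$ (Suc i, Suc j))"
  have "C \<in> carrier_mat n n"
    by (simp add: C_def)
  moreover have "mat_adjoint C = C"
    by (rule eq_matI) (auto simp: C_def simp flip: Bsym)
  ultimately obtain U a where U: "is_unitary n U" and CU: "C = udiag n U (\<lambda>i. complex_of_real (a i))"
    using Suc.IH by blast
  note U' = is_unitaryD[OF U]
  define V where "V = Matrix.mat ?k ?k
    (\<lambda>(i, j). if i = 0 \<or> j = 0 then (if i = j then 1 else 0) else U $$ (i - 1, j - 1))"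
  have V: "V \<in> carrier_mat ?k ?k"
    by (simp add: V_def)
  have V_index: "udiag ?k V d $$ (i, j) =
      (if i = 0 \<or> j = 0 then (if i = j then d 0 else 0) else udiag n U (\<lambda>l. d (Suc l)) $$ (i - 1, j - 1))"
    if "i < ?k" "j < ?k" for i j d
    using that U' V by (auto simp: udiag_index sum.lessThan_Suc_shift V_def simp del: sum.lessThan_Suc)
  have "udiag ?k V (\<lambda>_. 1) = 1\<^sub>m ?k"
    by (rule eq_matI) (use U' V in \<open>auto simp: V_index udiag_const_one[OF U'(1)]\<close>)
  then have "is_unitary ?k V"
    using V by (intro is_unitaryI) (auto simp: udiag_const_one)
  moreover define a' where "a' i = (case i of 0 \<Rightarrow> Re e | Suc l \<Rightarrow> a l)" for i
  have "B = udiag ?k V (\<lambda>i. complex_of_real (a' i))"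
  proof (rule eq_matI)
    fix i j assume "i < dim_row (udiag ?k V (\<lambda>i. complex_of_real (a' i)))"
      "j < dim_col (udiag ?k V (\<lambda>i. complex_of_real (a' i)))"
    then have ij: "i < ?k" "j < ?k"
      using V by auto
    have "B $$ (0, j) = cnj (B $$ (j, 0))"
      using Bsym ij by blast
    then have "B $$ (0, j) = (if j = 0 then e else 0)"
      unfolding B0[OF ij(2)] by (simp add: cnj_e)
    moreover have "B $$ (i, j) = C $$ (i - 1, j - 1)" if "i \<noteq> 0" "j \<noteq> 0"
      using that ij by (simp add: C_def)
    ultimately show "B $$ (i, j) = udiag ?k V (\<lambda>i. complex_of_real (a' i)) $$ (i, j)"
      unfolding V_index[OF ij] using B0[OF ij(1)] e_real CU by (auto simp: a'_def)
  qed (use B V in auto)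
  then have "A = udiag ?k (W * V) (\<lambda>i. complex_of_real (a' i))"
    using WB udiag_conjugate[OF W'(1) V] by metis
  ultimately show ?case
    using is_unitary_mult[OF W] by blast
qed


lemma exists_sorting_permutation:
  fixes a :: "nat \<Rightarrow> real"
  shows "\<exists>\<pi>. bij_betw \<pi> {..<k} {..<k} \<and> (\<forall>i j. i \<le> j \<longrightarrow> j < k \<longrightarrow> a (\<pi> i) \<le> a (\<pi> j))"
proof -
  define xs where "xs = sort_key a [0..<k]"
  have xs: "distinct xs" "set xs = {..<k}" "length xs = k" "sorted (map a xs)"
    unfolding xs_def distinct_sort set_sort length_sort
    by (rule distinct_upt atLeast_upt[symmetric] sorted_sort_key | simp only: length_upt diff_zero)+
  have "bij_betw ((!) xs) {..<k} {..<k}"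
    by (rule bij_betw_nth) (simp_all only: xs)
  moreover have "a (xs ! i) \<le> a (xs ! j)" if "i \<le> j" "j < k" for i j
    using sorted_nth_mono[OF xs(4) that(1)] that xs(3) by simp
  ultimately show ?thesis
    by blast
qed

text \<open>With the eigenvalues in increasing order, two matrices with the same multiplicities have the same
  eigenvalue sequence and are compared entry by entry.\<close>

lemma hermitian_sorted_diagonalisation:
  assumes "A \<in> carrier_mat k k" "mat_adjoint A = A"
  shows "\<exists>U a. is_unitary k U \<and> A = udiag k U (\<lambda>i. complex_of_real (a i))
           \<and> (\<forall>i j. i \<le> j \<longrightarrow> j < k \<longrightarrow> a i \<le> a j)"
proof -
  obtain U a where U: "is_unitary k U" and A: "A = udiag k U (\<lambda>i. complex_of_real (a i))"
    using hermitian_diagonalisation[OF assms] by blast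
  note U' = is_unitaryD[OF U]
  obtain \<pi> where \<pi>: "bij_betw \<pi> {..<k} {..<k}"
    and mono: "\<And>i j. i \<le> j \<Longrightarrow> j < k \<Longrightarrow> a (\<pi> i) \<le> a (\<pi> j)"
    using exists_sorting_permutation[of k a] by blast
  have \<pi>_less: "\<pi> i < k" if "i < k" for i
    using bij_betwE[OF \<pi>] that by auto
  define V where "V = Matrix.mat k k (\<lambda>(i, j). U $$ (i, \<pi> j))"
  have V: "V \<in> carrier_mat k k"
    by (simp add: V_def)
  have VU: "udiag k V (\<lambda>i. d (\<pi> i)) = udiag k U d" for d
  proof (rule eq_matI)
    fix i j assume "i < dim_row (udiag k U d)" "j < dim_col (udiag k U d)"
    then have ij: "i < k" "j < k"
      using U' by auto
    have "udiag k V (\<lambda>i. d (\<pi> i)) $$ (i, j) = (\<Sum>l<k. U $$ (i, \<pi> l) * d (\<pi> l) * cnj (U $$ (j, \<pi> l)))"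
      using ij V by (simp add: udiag_index) (simp add: V_def)
    also have "\<dots> = (\<Sum>l<k. U $$ (i, l) * d l * cnj (U $$ (j, l)))"
      by (rule sum.reindex_bij_betw[OF \<pi>])
    finally show "udiag k V (\<lambda>i. d (\<pi> i)) $$ (i, j) = udiag k U d $$ (i, j)"
      using ij U' by (simp add: udiag_index)
  qed (use U' V in auto)
  have "is_unitary k V"
    using V VU[of "\<lambda>_. 1"] U' by (intro is_unitaryI) (simp_all add: udiag_const_one)
  moreover have "A = udiag k V (\<lambda>i. complex_of_real (a (\<pi> i)))"
    unfolding A by (rule VU[of "\<lambda>i. complex_of_real (a i)", symmetric])
  moreover have "\<forall>i j. i \<le> j \<longrightarrow> j < k \<longrightarrow> a (\<pi> i) \<le> a (\<pi> j)"
    using mono by blast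
  ultimately show ?thesis
    by (intro exI[of _ V] exI[of _ "\<lambda>i. a (\<pi> i)"] conjI)
qed

subsection \<open>The operator norm\<close>

lemma vec_l2_norm_nonneg [simp]: "0 \<le> vec_l2_norm v"
  by (simp add: vec_l2_norm_def sum_nonneg)

lemma vec_l2_norm_L2_set: "v \<in> carrier_vec k \<Longrightarrow> vec_l2_norm v = L2_set (\<lambda>i. cmod (v $ i)) {..<k}"
  by (auto simp: vec_l2_norm_def L2_set_def)

lemma vec_l2_norm_sq: "v \<in> carrier_vec k \<Longrightarrow> (vec_l2_norm v)\<^sup>2 = (\<Sum>i<k. (cmod (v $ i))\<^sup>2)"
  by (auto simp: vec_l2_norm_def sum_nonneg)

lemma vec_l2_norm_smult: "vec_l2_norm (c \<cdot>\<^sub>v v) = cmod c * vec_l2_norm v"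
proof -
  have "(\<Sum>i<dim_vec v. (cmod (c * v $ i))\<^sup>2) = (cmod c)\<^sup>2 * (\<Sum>i<dim_vec v. (cmod (v $ i))\<^sup>2)"
    by (simp add: norm_mult power_mult_distrib sum_distrib_left)
  then show ?thesis
    by (simp add: vec_l2_norm_def real_sqrt_mult)
qed

lemma vec_l2_norm_eq_0_iff: "v \<in> carrier_vec k \<Longrightarrow> vec_l2_norm v = 0 \<longleftrightarrow> v = 0\<^sub>v k"
  by (auto simp: vec_l2_norm_def sum_nonneg_eq_0_iff intro!: eq_vecI)

lemma cscalar_prod_adjoint:
  fixes A :: "complex mat"
  assumes "A \<in> carrier_mat n m" "v \<in> carrier_vec m" "w \<in> carrier_vec n"
  shows "(A *\<^sub>v v) \<bullet>c w = v \<bullet>c (mat_adjoint A *\<^sub>v w)"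
proof -
  have "(A *\<^sub>v v) \<bullet>c w = (\<Sum>i<n. \<Sum>j<m. A $$ (i, j) * v $ j * cnj (w $ i))"
    using assms by (simp add: scalar_prod_def lessThan_atLeast0 sum_distrib_right)
  also have "\<dots> = (\<Sum>j<m. \<Sum>i<n. A $$ (i, j) * v $ j * cnj (w $ i))"
    by (rule sum.swap)
  also have "\<dots> = v \<bullet>c (mat_adjoint A *\<^sub>v w)"
    using assms by (simp add: scalar_prod_def lessThan_atLeast0 sum_distrib_left algebra_simps)
  finally show ?thesis .
qed

lemma vec_l2_norm_unitary:
  assumes "is_unitary k W" "v \<in> carrier_vec k"
  shows "vec_l2_norm (W *\<^sub>v v) = vec_l2_norm v"
proof -
  note W = is_unitaryD[OF assms(1)]
  have "(W *\<^sub>v v) \<bullet>c (W *\<^sub>v v) = v \<bullet>c (mat_adjoint W *\<^sub>v (W *\<^sub>v v))"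
    using W assms by (intro cscalar_prod_adjoint[of _ k k]) auto
  also have "mat_adjoint W *\<^sub>v (W *\<^sub>v v) = v"
    using W assms(2) by (simp flip: assoc_mult_mat_vec[of _ k k _ k])
  finally have "(vec_l2_norm (W *\<^sub>v v))\<^sup>2 = (vec_l2_norm v)\<^sup>2"
    unfolding cscalar_prod_vec_l2_norm by (simp only: of_real_eq_iff)
  then show ?thesis
    by (simp add: power2_eq_iff_nonneg)
qed

lemma mat_diag_mult_vec:
  "w \<in> carrier_vec k \<Longrightarrow> mat_diag k d *\<^sub>v w = Matrix.vec k (\<lambda>i. d i * w $ i)"
  by (rule eq_vecI)
    (auto simp: mat_diag_def scalar_prod_def if_distrib[of "\<lambda>x. x * _"] sum.delta cong: if_cong)

lemma udiag_mult_vec: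
  assumes "U \<in> carrier_mat k k" "v \<in> carrier_vec k"
  shows "udiag k U d *\<^sub>v v = U *\<^sub>v Matrix.vec k (\<lambda>i. d i * (mat_adjoint U *\<^sub>v v) $ i)"
proof -
  have "udiag k U d *\<^sub>v v = U *\<^sub>v (mat_diag k d *\<^sub>v (mat_adjoint U *\<^sub>v v))"
    using assms by (simp add: udiag_def assoc_mult_mat_vec[of _ k k _ k] mult_carrier_mat[of _ k k _ k]
        mult_mat_vec_carrier[of _ k k])
  then show ?thesis
    using assms by (simp add: mat_diag_mult_vec mult_mat_vec_carrier[of _ k k])
qed

lemma vec_l2_norm_udiag_le:
  assumes U: "is_unitary k U" and v: "v \<in> carrier_vec k"
    and c: "0 \<le> c" "\<And>i. i < k \<Longrightarrow> cmod (d i) \<le> c"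
  shows "vec_l2_norm (udiag k U d *\<^sub>v v) \<le> c * vec_l2_norm v"
proof -
  note U' = is_unitaryD[OF U]
  define w where "w = mat_adjoint U *\<^sub>v v"
  have w: "w \<in> carrier_vec k" "vec_l2_norm w = vec_l2_norm v"
    using vec_l2_norm_unitary[OF is_unitary_adjoint[OF U] v] U' v
    by (auto simp: w_def mult_mat_vec_carrier[of _ k k])
  have "vec_l2_norm (udiag k U d *\<^sub>v v) = vec_l2_norm (Matrix.vec k (\<lambda>i. d i * w $ i))"
    using U' v by (simp add: udiag_mult_vec vec_l2_norm_unitary[OF U] flip: w_def)
  then have "(vec_l2_norm (udiag k U d *\<^sub>v v))\<^sup>2 = (\<Sum>i<k. (cmod (d i))\<^sup>2 * (cmod (w $ i))\<^sup>2)"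
    by (simp add: vec_l2_norm_sq[of _ k] norm_mult power_mult_distrib)
  also have "\<dots> \<le> (\<Sum>i<k. c\<^sup>2 * (cmod (w $ i))\<^sup>2)"
    using c by (intro sum_mono mult_right_mono power_mono) auto
  also have "\<dots> = (c * vec_l2_norm v)\<^sup>2"
    by (simp add: vec_l2_norm_sq[OF w(1)] power_mult_distrib flip: w(2) sum_distrib_left)
  finally show ?thesis
    by (rule power2_le_imp_le) (use c in auto)
qed

lemma mat_op_norm_udiag_le:
  assumes U: "is_unitary k U" and c: "0 \<le> c" "\<And>i. i < k \<Longrightarrow> cmod (d i) \<le> c"
  shows "mat_op_norm (udiag k U d) \<le> c"
  unfolding mat_op_norm_def
proof (rule cSup_least)
  have "0\<^sub>v k \<in> carrier_vec (dim_col (udiag k U d))" "vec_l2_norm (0\<^sub>v k) \<le> 1"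
    using is_unitaryD[OF U] by (auto simp: vec_l2_norm_def)
  then show "{vec_l2_norm (udiag k U d *\<^sub>v v) |v.
      v \<in> carrier_vec (dim_col (udiag k U d)) \<and> vec_l2_norm v \<le> 1} \<noteq> {}"
    by blast
next
  fix y assume "y \<in> {vec_l2_norm (udiag k U d *\<^sub>v v) |v.
      v \<in> carrier_vec (dim_col (udiag k U d)) \<and> vec_l2_norm v \<le> 1}"
  then obtain v where v: "v \<in> carrier_vec k" "vec_l2_norm v \<le> 1" "y = vec_l2_norm (udiag k U d *\<^sub>v v)"
    using is_unitaryD[OF U] by auto
  have "y \<le> c * vec_l2_norm v"
    unfolding v(3) by (rule vec_l2_norm_udiag_le) (use U v c in auto)
  also have "\<dots> \<le> c"
    using v c by (simp add: mult_left_le)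
  finally show "y \<le> c" .
qed

text \<open>The operator norm is a supremum of reals, which is meaningful only for a bounded set. The sum of
  the \<open>\<bar>d i\<bar>\<close> serves as a bound.\<close>

lemma vec_l2_norm_le_mat_op_norm:
  assumes U: "is_unitary k U" and v: "v \<in> carrier_vec k"
  shows "vec_l2_norm (udiag k U d *\<^sub>v v) \<le> mat_op_norm (udiag k U d) * vec_l2_norm v"
proof -
  define c where "c = (\<Sum>i<k. cmod (d i))"
  have c: "0 \<le> c" "\<And>i. i < k \<Longrightarrow> cmod (d i) \<le> c"
    by (auto simp: c_def sum_nonneg intro: member_le_sum)
  note U' = is_unitaryD[OF U]
  let ?S = "{vec_l2_norm (udiag k U d *\<^sub>v v) |v. v \<in> carrier_vec k \<and> vec_l2_norm v \<le> 1}"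
  have "y \<le> c" if y: "y \<in> ?S" for y
  proof -
    obtain v where v: "v \<in> carrier_vec k" "vec_l2_norm v \<le> 1" "y = vec_l2_norm (udiag k U d *\<^sub>v v)"
      using y by auto
    have "y \<le> c * vec_l2_norm v"
      unfolding v(3) by (rule vec_l2_norm_udiag_le) (use U v c in auto)
    also have "\<dots> \<le> c"
      using v c by (simp add: mult_left_le)
    finally show ?thesis .
  qed
  then have bdd: "bdd_above ?S"
    by (rule bdd_aboveI)
  show ?thesis
  proof (cases "vec_l2_norm v = 0")
    case True
    then show ?thesis
      using vec_l2_norm_udiag_le[OF U v c] by simp
  next
    case False
    define w where "w = complex_of_real (1 / vec_l2_norm v) \<cdot>\<^sub>v v"
    have w: "w \<in> carrier_vec k" "vec_l2_norm w = 1"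
      using v False by (auto simp: w_def vec_l2_norm_smult norm_divide)
    have "vec_l2_norm (udiag k U d *\<^sub>v w) \<le> mat_op_norm (udiag k U d)"
      unfolding mat_op_norm_def using w U' by (intro cSup_upper) (use bdd in auto)
    moreover have "vec_l2_norm (udiag k U d *\<^sub>v w) = vec_l2_norm (udiag k U d *\<^sub>v v) / vec_l2_norm v"
      unfolding w_def using v U'(1) by (simp add: mult_mat_vec[of _ k k] vec_l2_norm_smult norm_divide)
    moreover have "0 < vec_l2_norm v"
      using False vec_l2_norm_nonneg[of v] by linarith
    ultimately show ?thesis
      by (simp add: field_simps)
  qed
qed

lemma mat_op_norm_udiag_ge:
  assumes U: "is_unitary k U" and i: "i < k"
  shows "cmod (d i) \<le> mat_op_norm (udiag k U d)"
proof -
  note U' = is_unitaryD[OF U]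
  let ?v = "U *\<^sub>v unit_vec k i"
  have v: "?v \<in> carrier_vec k"
    using U' by (auto simp: mult_mat_vec_carrier[of _ k k])
  have "mat_adjoint U *\<^sub>v ?v = unit_vec k i"
    using U' by (simp flip: assoc_mult_mat_vec[of _ k k _ k])
  then have "udiag k U d *\<^sub>v ?v = U *\<^sub>v (d i \<cdot>\<^sub>v unit_vec k i)"
    using U' v i by (subst udiag_mult_vec) (auto intro!: arg_cong[of _ _ "\<lambda>w. U *\<^sub>v w"] eq_vecI)
  moreover have "vec_l2_norm (unit_vec k i) = 1"
  proof -
    have "(vec_l2_norm (unit_vec k i))\<^sup>2 = (\<Sum>j<k. if j = i then 1 else 0)"
      unfolding vec_l2_norm_sq[OF unit_vec_carrier] by (rule sum.cong) (use i in auto)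
    also have "\<dots> = 1"
      using i by simp
    finally show ?thesis
      by (metis power2_eq_iff_nonneg one_power2 vec_l2_norm_nonneg zero_le_one)
  qed
  ultimately have "vec_l2_norm (udiag k U d *\<^sub>v ?v) = cmod (d i)" "vec_l2_norm ?v = 1"
    by (simp_all add: vec_l2_norm_unitary[OF U] vec_l2_norm_smult)
  then show ?thesis
    using vec_l2_norm_le_mat_op_norm[OF U v, of d] by simp
qed

section \<open>Orbit balls and eigenvalue counts\<close>

abbreviation rdiag :: "nat \<Rightarrow> complex mat \<Rightarrow> (nat \<Rightarrow> real) \<Rightarrow> complex mat"
  where "rdiag k U a \<equiv> udiag k U (\<lambda>i. complex_of_real (a i))"

text \<open>Padded with zero rows to a square matrix, the system has determinant \<open>0\<close>.\<close>

lemma homogeneous_system_solution: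
  fixes L :: "complex vec list"
  assumes L: "set L \<subseteq> carrier_vec k" "length L < k"
  shows "\<exists>v\<in>carrier_vec k. v \<noteq> 0\<^sub>v k \<and> (\<forall>r\<in>set L. r \<bullet> v = 0)"
proof -
  define c where "c i = (if i < length L then L ! i else 0\<^sub>v k)" for i
  define M where "M = mat\<^sub>r k k (\<lambda>i. if i = k - 1 then 0\<^sub>v k else c i)"
  have c: "c i \<in> carrier_vec k" for i
    using L nth_mem[of i L] by (auto simp: c_def)
  have M: "M \<in> carrier_mat k k"
    by (simp add: M_def)
  have "Determinant.det M = 0"
    unfolding M_def by (rule det_row_0) (use L c in auto)
  then obtain v where v: "v \<in> carrier_vec k" "v \<noteq> 0\<^sub>v k" "M *\<^sub>v v = 0\<^sub>v k"
    using det_0_iff_vec_prod_zero[OF M] by blast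
  have "r \<bullet> v = 0" if r: "r \<in> set L" for r
  proof -
    obtain i where i: "i < length L" "r = L ! i"
      using r by (auto simp: in_set_conv_nth)
    moreover have "i < k" "i \<noteq> k - 1"
      using i L by auto
    ultimately have "Matrix.row M i = r"
      using c[of i] by (simp add: M_def) (simp add: c_def)
    moreover have "(M *\<^sub>v v) $ i = 0"
      using v i L by simp
    ultimately show ?thesis
      using i L M by simp
  qed
  with v show ?thesis
    by blast
qed

lemma cmod_cscalar_prod_le:
  assumes "z \<in> carrier_vec k" "v \<in> carrier_vec k"
  shows "cmod (z \<bullet>c v) \<le> vec_l2_norm z * vec_l2_norm v"
proof -
  have "cmod (z \<bullet>c v) = cmod (\<Sum>i<k. z $ i * cnj (v $ i))"
    using assms by (simp add: scalar_prod_def lessThan_atLeast0)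
  also have "\<dots> \<le> (\<Sum>i<k. \<bar>cmod (z $ i)\<bar> * \<bar>cmod (v $ i)\<bar>)"
    by (rule order_trans[OF norm_sum]) (simp add: norm_mult)
  also have "\<dots> \<le> vec_l2_norm z * vec_l2_norm v"
    using assms by (simp only: vec_l2_norm_L2_set) (rule L2_set_mult_ineq)
  finally show ?thesis .
qed

lemma rdiag_quadratic_form:
  assumes "U \<in> carrier_mat k k" "v \<in> carrier_vec k"
  shows "(rdiag k U a *\<^sub>v v) \<bullet>c v
    = complex_of_real (\<Sum>i<k. a i * (cmod ((mat_adjoint U *\<^sub>v v) $ i))\<^sup>2)"
proof -
  define p where "p = mat_adjoint U *\<^sub>v v"
  have p: "p \<in> carrier_vec k"
    using assms by (auto simp: p_def mult_mat_vec_carrier[of _ k k])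
  have "(rdiag k U a *\<^sub>v v) \<bullet>c v = Matrix.vec k (\<lambda>i. complex_of_real (a i) * p $ i) \<bullet>c p"
    unfolding p_def using assms by (simp add: udiag_mult_vec cscalar_prod_adjoint[of _ k k])
  also have "\<dots> = (\<Sum>i<k. complex_of_real (a i) * (p $ i * cnj (p $ i)))"
    using p by (simp add: scalar_prod_def lessThan_atLeast0 mult.assoc)
  also have "\<dots> = complex_of_real (\<Sum>i<k. a i * (cmod (p $ i))\<^sup>2)"
    by (simp flip: complex_norm_square)
  finally show ?thesis
    by (simp add: p_def)
qed

text \<open>Counting through \<open>filter\<close> turns eigenvalue counts into lengths of lists, which add up without finiteness
  side conditions.\<close>

lemma card_filter_upt: "card {i. i < k \<and> P i} = length (filter P [0..<k])"
  by (simp add: length_filter_conv_card cong: conj_cong)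

text \<open>Weyl's inequality in terms of counts. If it failed, the span of the eigenvectors of the first matrix with
  eigenvalue at most \<open>t\<close> and the span of those of the second with eigenvalue at least \<open>t + d\<close> would
  have dimensions adding up to more than \<open>k\<close>. On a common nonzero vector the two quadratic forms would
  differ by at least \<open>d\<close>. The hypothesis bounds the difference of the quadratic forms, and not the norm
  of the difference of the matrices, because in this form it is visibly symmetric.\<close>

lemma eigenvalue_count_le:
  assumes U: "is_unitary k U" and V: "is_unitary k V" and d: "d0 < d"
    and close: "\<And>v. v \<in> carrier_vec k \<Longrightarrow>
      cmod ((rdiag k U a *\<^sub>v v) \<bullet>c v - (rdiag k V b *\<^sub>v v) \<bullet>c v) \<le> d0 * (vec_l2_norm v)\<^sup>2"
  shows "card {i. i < k \<and> a i \<le> t} \<le> card {i. i < k \<and> b i < t + d}"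
proof (rule ccontr)
  assume less: "\<not> ?thesis"
  note U' = is_unitaryD[OF U] and V' = is_unitaryD[OF V]
  \<comment> \<open>The equations that confine \<open>v\<close> to both spans.\<close>
  define L where "L = map (Matrix.row (mat_adjoint U)) (filter (\<lambda>i. \<not> a i \<le> t) [0..<k])
    @ map (Matrix.row (mat_adjoint V)) (filter (\<lambda>i. b i < t + d) [0..<k])"
  have "length (filter (\<lambda>i. a i \<le> t) [0..<k]) + length (filter (\<lambda>i. \<not> a i \<le> t) [0..<k]) = k"
    using sum_length_filter_compl[of "\<lambda>i. a i \<le> t" "[0..<k]"] by simp
  then have "length L < k"
    using less by (simp add: L_def card_filter_upt)
  moreover have "set L \<subseteq> carrier_vec k"
    using U' V' by (auto simp: L_def)
  ultimately obtain v where v: "v \<in> carrier_vec k" "v \<noteq> 0\<^sub>v k" "\<And>r. r \<in> set L \<Longrightarrow> r \<bullet> v = 0"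
    using homogeneous_system_solution by blast
  define p q where "p = mat_adjoint U *\<^sub>v v" and "q = mat_adjoint V *\<^sub>v v"
  have pq: "p \<in> carrier_vec k" "q \<in> carrier_vec k"
    using U' V' v by (auto simp: p_def q_def mult_mat_vec_carrier[of _ k k])
  have norms: "vec_l2_norm p = vec_l2_norm v" "vec_l2_norm q = vec_l2_norm v"
    unfolding p_def q_def using vec_l2_norm_unitary is_unitary_adjoint U V v(1) by blast+
  have p0: "p $ i = 0" if "i < k" "\<not> a i \<le> t" for i
    using that U' v(3)[of "Matrix.row (mat_adjoint U) i"] by (auto simp: p_def L_def)
  have q0: "q $ i = 0" if "i < k" "b i < t + d" for i
    using that V' v(3)[of "Matrix.row (mat_adjoint V) i"] by (auto simp: q_def L_def)
  have "(\<Sum>i<k. a i * (cmod (p $ i))\<^sup>2) \<le> (\<Sum>i<k. t * (cmod (p $ i))\<^sup>2)"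
  proof (rule sum_mono)
    fix i assume "i \<in> {..<k}"
    then show "a i * (cmod (p $ i))\<^sup>2 \<le> t * (cmod (p $ i))\<^sup>2"
      using p0[of i] by (cases "a i \<le> t") (auto intro: mult_right_mono)
  qed
  also have "\<dots> = t * (vec_l2_norm v)\<^sup>2"
    by (simp add: vec_l2_norm_sq[OF pq(1)] flip: norms(1) sum_distrib_left)
  finally have a: "(\<Sum>i<k. a i * (cmod (p $ i))\<^sup>2) \<le> t * (vec_l2_norm v)\<^sup>2" .
  have "(\<Sum>i<k. b i * (cmod (q $ i))\<^sup>2) \<ge> (\<Sum>i<k. (t + d) * (cmod (q $ i))\<^sup>2)"
  proof (rule sum_mono)
    fix i assume "i \<in> {..<k}"
    then show "(t + d) * (cmod (q $ i))\<^sup>2 \<le> b i * (cmod (q $ i))\<^sup>2"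
      using q0[of i] by (cases "b i < t + d") (auto intro: mult_right_mono)
  qed
  moreover have "(\<Sum>i<k. (t + d) * (cmod (q $ i))\<^sup>2) = (t + d) * (vec_l2_norm v)\<^sup>2"
    by (simp only: vec_l2_norm_sq[OF pq(2)] norms(2)[symmetric] sum_distrib_left)
  ultimately have b: "(t + d) * (vec_l2_norm v)\<^sup>2 \<le> (\<Sum>i<k. b i * (cmod (q $ i))\<^sup>2)"
    by linarith
  have "\<bar>(\<Sum>i<k. a i * (cmod (p $ i))\<^sup>2) - (\<Sum>i<k. b i * (cmod (q $ i))\<^sup>2)\<bar> \<le> d0 * (vec_l2_norm v)\<^sup>2"
    using close[OF v(1)]
    unfolding rdiag_quadratic_form[OF U'(1) v(1)] rdiag_quadratic_form[OF V'(1) v(1)]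
      of_real_diff[symmetric] norm_of_real p_def q_def .
  with a b have "(t + d) * (vec_l2_norm v)\<^sup>2 - t * (vec_l2_norm v)\<^sup>2 \<le> d0 * (vec_l2_norm v)\<^sup>2"
    by linarith
  then have "d * (vec_l2_norm v)\<^sup>2 \<le> d0 * (vec_l2_norm v)\<^sup>2"
    by (simp add: algebra_simps)
  moreover have "0 < (vec_l2_norm v)\<^sup>2"
    using v vec_l2_norm_eq_0_iff[of v k] by simp
  ultimately show False
    using d by simp
qed

text \<open>The difference of the first matrix and the conjugate of the second is self-adjoint, so that its operator
  norm does bound its quadratic form.\<close>

lemma orbit_ball_eigenvalue_counts:
  assumes U: "is_unitary k U" and V: "is_unitary k V"
    and ball: "rdiag k U a \<in> orbit_ball k (rdiag k V b) \<omega>"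
  shows "card {i. i < k \<and> a i \<le> t} \<le> card {i. i < k \<and> b i < t + \<omega>}"
    and "card {i. i < k \<and> b i \<le> t} \<le> card {i. i < k \<and> a i < t + \<omega>}"
proof -
  note U' = is_unitaryD[OF U] and V' = is_unitaryD[OF V]
  obtain W where W: "is_unitary k W"
    and "mat_op_norm (rdiag k U a - W * rdiag k V b * mat_adjoint W) < \<omega>"
    using ball by (auto simp: orbit_ball_def)
  moreover define V2 where "V2 = W * V"
  ultimately have less: "mat_op_norm (rdiag k U a - rdiag k V2 b) < \<omega>"
    using udiag_conjugate[OF is_unitaryD(1)[OF W] V'(1)] by simp
  have V2: "is_unitary k V2"
    unfolding V2_def by (rule is_unitary_mult[OF W V])
  note V2' = is_unitaryD[OF V2]
  define D where "D = rdiag k U a - rdiag k V2 b"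
  have D: "D \<in> carrier_mat k k"
    using U' V2' by (auto simp: D_def intro!: minus_carrier_mat)
  have "mat_adjoint D = D"
  proof (rule eq_matI)
    fix i j assume "i < dim_row D" "j < dim_col D"
    then have ij: "i < k" "j < k"
      using D by auto
    have "mat_adjoint (rdiag k U a) $$ (i, j) = rdiag k U a $$ (i, j)"
      "mat_adjoint (rdiag k V2 b) $$ (i, j) = rdiag k V2 b $$ (i, j)"
      unfolding udiag_adjoint[OF U'(1)] udiag_adjoint[OF V2'(1)] by simp_all
    then show "mat_adjoint D $$ (i, j) = D $$ (i, j)"
      using ij U' V2' by (simp add: D_def)
  qed (use D in auto)
  then obtain Z c where Z: "is_unitary k Z" "D = rdiag k Z c"
    using hermitian_diagonalisation[OF D] by blast
  have close: "cmod ((rdiag k U a *\<^sub>v v) \<bullet>c v - (rdiag k V2 b *\<^sub>v v) \<bullet>c v)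
      \<le> mat_op_norm D * (vec_l2_norm v)\<^sup>2" if v: "v \<in> carrier_vec k" for v
  proof -
    have "(rdiag k U a *\<^sub>v v) \<bullet>c v - (rdiag k V2 b *\<^sub>v v) \<bullet>c v = (D *\<^sub>v v) \<bullet>c v"
      using U' V2' v
      by (simp add: D_def minus_mult_distrib_mat_vec[of _ k k] minus_scalar_prod_distrib[of _ k]
          mult_mat_vec_carrier[of _ k k])
    also have "cmod \<dots> \<le> vec_l2_norm (D *\<^sub>v v) * vec_l2_norm v"
      using D v by (intro cmod_cscalar_prod_le[of _ k]) (auto simp: mult_mat_vec_carrier[of _ k k])
    also have "\<dots> \<le> mat_op_norm D * vec_l2_norm v * vec_l2_norm v"
      unfolding Z(2) by (intro mult_right_mono vec_l2_norm_le_mat_op_norm Z(1) v vec_l2_norm_nonneg)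
    finally show ?thesis
      by (simp add: power2_eq_square mult.assoc)
  qed
  show "card {i. i < k \<and> a i \<le> t} \<le> card {i. i < k \<and> b i < t + \<omega>}"
    by (rule eigenvalue_count_le[OF U V2 _ close]) (use less D_def in auto)
  show "card {i. i < k \<and> b i \<le> t} \<le> card {i. i < k \<and> a i < t + \<omega>}"
    by (rule eigenvalue_count_le[OF V2 U, where ?d0.0 = "mat_op_norm D"])
      (use less close in \<open>auto simp: D_def norm_minus_commute\<close>)
qed

text \<open>The unitary that carries one eigenbasis to the other leaves only the differences of the eigenvalues.\<close>

lemma rdiag_in_orbit_ball:
  assumes U: "is_unitary k U" and V: "is_unitary k V"
    and c: "0 \<le> c" "c < \<omega>" "\<And>i. i < k \<Longrightarrow> \<bar>a i - b i\<bar> \<le> c"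
  shows "rdiag k U a \<in> orbit_ball k (rdiag k V b) \<omega>"
proof -
  note U' = is_unitaryD[OF U] and V' = is_unitaryD[OF V]
  define W where "W = U * mat_adjoint V"
  have W: "is_unitary k W"
    unfolding W_def by (rule is_unitary_mult[OF U is_unitary_adjoint[OF V]])
  have "W * V = U"
    using U' V' by (simp add: W_def assoc_mult_mat[of _ k k _ k _ k])
  then have "rdiag k U a - W * rdiag k V b * mat_adjoint W
      = udiag k U (\<lambda>i. complex_of_real (a i) - complex_of_real (b i))"
    by (simp add: udiag_conjugate[OF is_unitaryD(1)[OF W] V'(1)] udiag_minus[OF U'(1)])
  also have "mat_op_norm \<dots> \<le> c"
    by (rule mat_op_norm_udiag_le[OF U c(1)]) (use c in \<open>simp flip: of_real_diff\<close>)
  finally show ?thesis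
    using W U' c by (auto simp: orbit_ball_def)
qed

subsection \<open>Covering by few orbit balls\<close>

lemma sorted_functions_eqI:
  fixes f g :: "nat \<Rightarrow> real"
  assumes f: "\<And>i j. i \<le> j \<Longrightarrow> j < k \<Longrightarrow> f i \<le> f j"
    and g: "\<And>i j. i \<le> j \<Longrightarrow> j < k \<Longrightarrow> g i \<le> g j"
    and counts: "\<And>t. card {i. i < k \<and> f i = t} = card {i. i < k \<and> g i = t}"
    and i: "i < k"
  shows "f i = g i"
proof -
  define xs ys where "xs = map f [0..<k]" and "ys = map g [0..<k]"
  have sorted: "sorted xs" "sorted ys"
    using f g by (auto simp: xs_def ys_def sorted_iff_nth_mono)
  have "count (mset xs) t = count (mset ys) t" for t
    using counts[of t] unfolding xs_def ys_def count_mset count_list_eq_length_filter filter_map length_map comp_def card_filter_upt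
    by (simp only: eq_commute[of t])
  then have "mset xs = mset ys"
    by (rule multiset_eqI)
  then have "xs = ys"
    using sorted properties_for_sort by metis
  then have "xs ! i = ys ! i"
    by simp
  then show ?thesis
    using i by (simp add: xs_def ys_def)
qed

text \<open>Round every eigenvalue to a point of \<open>F\<close> within \<open>\<rho>\<close>. If the rounding is monotone, then matrices with the
  same multiplicities after rounding have, index by index, the same rounded eigenvalues; hence their sorted
  eigenvalues differ by at most \<open>2 * \<rho>\<close>. It remains to count vectors of multiplicities, and to choose the
  centre of each class inside the class, since centres have to belong to \<open>S\<close>.\<close>

lemma orbit_cover_exists:
  assumes S: "\<And>A. A \<in> S \<Longrightarrow> A \<in> carrier_mat k k \<and> mat_adjoint A = A"
    and F: "finite F" and \<rho>: "0 \<le> \<rho>" "2 * \<rho> < \<omega>"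
    and near: "\<And>U a i. is_unitary k U \<Longrightarrow> rdiag k U a \<in> S \<Longrightarrow> i < k \<Longrightarrow> \<exists>t\<in>F. \<bar>a i - t\<bar> \<le> \<rho>"
  shows "\<exists>C. finite C \<and> C \<subseteq> S \<and> S \<subseteq> (\<Union>B\<in>C. orbit_ball k B \<omega>) \<and> card C \<le> (k + 1) ^ card F"
proof -
  have "\<forall>A\<in>S. \<exists>U a. is_unitary k U \<and> A = rdiag k U a \<and> (\<forall>i j. i \<le> j \<longrightarrow> j < k \<longrightarrow> a i \<le> a j)"
    using S hermitian_sorted_diagonalisation by blast
  then obtain U a where U: "\<And>A. A \<in> S \<Longrightarrow> is_unitary k (U A)"
    and A_eq: "\<And>A. A \<in> S \<Longrightarrow> A = rdiag k (U A) (a A)"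
    and mono: "\<And>A i j. A \<in> S \<Longrightarrow> i \<le> j \<Longrightarrow> j < k \<Longrightarrow> a A i \<le> a A j"
    by metis
  \<comment> \<open>Choosing the least admissible point makes monotonicity immediate: the set shrinks as \<open>l\<close> grows.\<close>
  define cell where "cell l = Min {t\<in>F. l \<le> t + \<rho>}" for l :: real
  have cell: "cell (a A i) \<in> F \<and> \<bar>a A i - cell (a A i)\<bar> \<le> \<rho>" if A: "A \<in> S" and i: "i < k" for A i
  proof -
    obtain t where t: "t \<in> F" "\<bar>a A i - t\<bar> \<le> \<rho>"
      using near[OF U[OF A], of "a A" i] A A_eq[OF A] i by auto
    let ?T = "{t\<in>F. a A i \<le> t + \<rho>}"
    have T: "finite ?T" "t \<in> ?T"
      using F t by auto
    have "cell (a A i) \<in> ?T"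
      unfolding cell_def by (rule Min_in) (use T in blast)+
    moreover have "cell (a A i) \<le> t"
      unfolding cell_def by (rule Min_le) (use T in blast)+
    ultimately have "cell (a A i) \<in> ?T" "cell (a A i) \<le> t"
      by blast+
    then show ?thesis
      using t by auto
  qed
  have cell_mono: "cell (a A i) \<le> cell (a A j)" if A: "A \<in> S" and ij: "i \<le> j" "j < k" for A i j
    unfolding cell_def
  proof (rule Min_antimono)
    show "{t\<in>F. a A j \<le> t + \<rho>} \<subseteq> {t\<in>F. a A i \<le> t + \<rho>}"
      using mono[OF A ij] by auto
    show "{t\<in>F. a A j \<le> t + \<rho>} \<noteq> {}"
      using near[OF U[OF A], of "a A" j] A A_eq[OF A] ij by force
  qed (use F in auto)
  define sig where "sig A = restrict (\<lambda>t. card {i. i < k \<and> cell (a A i) = t}) F" for A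
  have "sig A \<in> F \<rightarrow>\<^sub>E {..k}" for A
  proof -
    have "card {i. i < k \<and> P i} \<le> k" for P
      using card_mono[of "{..<k}" "{i. i < k \<and> P i}"] by auto
    then show ?thesis
      by (auto simp: sig_def)
  qed
  then have sub: "sig ` S \<subseteq> F \<rightarrow>\<^sub>E {..k}"
    by auto
  have fin: "finite (F \<rightarrow>\<^sub>E {..k})"
    using F by (intro finite_PiE) auto
  define C where "C = (\<lambda>A. inv_into S sig (sig A)) ` S"
  have C_alt: "C = inv_into S sig ` (sig ` S)"
    by (simp add: C_def image_image)
  have finC: "finite (sig ` S)"
    by (rule finite_subset[OF sub fin])
  have "card C \<le> card (sig ` S)"
    unfolding C_alt by (rule card_image_le[OF finC])
  also have "\<dots> \<le> card (F \<rightarrow>\<^sub>E {..k})"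
    by (rule card_mono[OF fin sub])
  also have "\<dots> = (k + 1) ^ card F"
    using F by (simp add: card_PiE)
  finally have "card C \<le> (k + 1) ^ card F" .
  moreover have "finite C"
    using finC by (simp add: C_alt)
  moreover have "C \<subseteq> S"
    by (auto simp: C_def inv_into_into)
  moreover have "A \<in> orbit_ball k (inv_into S sig (sig A)) \<omega>" if A: "A \<in> S" for A
  proof -
    define B where "B = inv_into S sig (sig A)"
    have B: "B \<in> S" "sig B = sig A"
      using A by (auto simp: B_def inv_into_into f_inv_into_f)
    have counts: "card {i. i < k \<and> cell (a A i) = t} = card {i. i < k \<and> cell (a B i) = t}" for t
    proof (cases "t \<in> F")
      case True
      then show ?thesis
        using fun_cong[OF B(2), of t] by (simp add: sig_def)
    next
      case False
      then have "{i. i < k \<and> cell (a A i) = t} = {}" "{i. i < k \<and> cell (a B i) = t} = {}"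
        using cell A B(1) by blast+
      then show ?thesis
        by (simp only:)
    qed
    have eq: "cell (a A i) = cell (a B i)" if "i < k" for i
      by (rule sorted_functions_eqI[of k "\<lambda>i. cell (a A i)" "\<lambda>i. cell (a B i)"])
        (use cell_mono A B(1) counts that in auto)
    have "\<bar>a A i - a B i\<bar> \<le> 2 * \<rho>" if "i < k" for i
      using cell[OF A that] cell[OF B(1) that] eq[OF that] by linarith
    then have "rdiag k (U A) (a A) \<in> orbit_ball k (rdiag k (U B) (a B)) \<omega>"
      using \<rho> by (intro rdiag_in_orbit_ball[OF U[OF A] U[OF B(1)], of "2 * \<rho>"]) auto
    then show ?thesis
      using A_eq[OF A] A_eq[OF B(1)] by (simp flip: B_def)
  qed
  then have "S \<subseteq> (\<Union>B\<in>C. orbit_ball k B \<omega>)"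
    by (auto simp: C_def)
  ultimately show ?thesis
    by blast
qed

lemma orbit_covering_number_le:
  assumes "finite C" "C \<subseteq> S" "S \<subseteq> (\<Union>B\<in>C. orbit_ball k B \<omega>)"
  shows "orbit_covering_number k S \<omega> \<le> card C"
  unfolding orbit_covering_number_def by (rule wellorder_Inf_le1) (use assms in blast)

text \<open>Some cover has to be known: the infimum of the empty set of natural numbers is \<open>0\<close>, which says
  nothing about covers.\<close>

lemma orbit_covering_number_attained:
  assumes "finite C" "C \<subseteq> S" "S \<subseteq> (\<Union>B\<in>C. orbit_ball k B \<omega>)"
  shows "\<exists>C. finite C \<and> C \<subseteq> S \<and> S \<subseteq> (\<Union>B\<in>C. orbit_ball k B \<omega>)
    \<and> card C = orbit_covering_number k S \<omega>"
proof -
  have "orbit_covering_number k S \<omega>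
      \<in> {card C | C. finite C \<and> C \<subseteq> S \<and> S \<subseteq> (\<Union>B\<in>C. orbit_ball k B \<omega>)}"
    unfolding orbit_covering_number_def by (rule Inf_nat_def1) (use assms in blast)
  then show ?thesis
    by auto
qed

text \<open>Two members of the family in one orbit ball have eigenvalue counts that interlace with the double
  tolerance \<open>2 * \<omega>\<close>, via those of the centre. If this forces them to be equal, then each ball contains
  at most one of them.\<close>

lemma card_le_orbit_cover:
  assumes S: "\<And>A. A \<in> S \<Longrightarrow> A \<in> carrier_mat k k \<and> mat_adjoint A = A"
    and C: "finite C" "C \<subseteq> S" "S \<subseteq> (\<Union>B\<in>C. orbit_ball k B \<omega>)"
    and I: "\<And>m. m \<in> I \<Longrightarrow> rdiag k (1\<^sub>m k) (a m) \<in> S"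
    and sep: "\<And>m n. m \<in> I \<Longrightarrow> n \<in> I \<Longrightarrow>
      (\<And>t. card {i. i < k \<and> a m i \<le> t} \<le> card {i. i < k \<and> a n i < t + 2 * \<omega>}) \<Longrightarrow>
      (\<And>t. card {i. i < k \<and> a n i \<le> t} \<le> card {i. i < k \<and> a m i < t + 2 * \<omega>}) \<Longrightarrow> m = n"
  shows "card I \<le> card C"
proof -
  have "\<forall>m\<in>I. \<exists>B\<in>C. rdiag k (1\<^sub>m k) (a m) \<in> orbit_ball k B \<omega>"
    using I C by blast
  then obtain B where B: "\<And>m. m \<in> I \<Longrightarrow> B m \<in> C"
    "\<And>m. m \<in> I \<Longrightarrow> rdiag k (1\<^sub>m k) (a m) \<in> orbit_ball k (B m) \<omega>"
    by metis
  have "inj_on B I"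
  proof (rule inj_onI)
    fix m n assume m: "m \<in> I" and n: "n \<in> I" and eq: "B m = B n"
    obtain V b where V: "is_unitary k V" "B m = rdiag k V b"
      using hermitian_diagonalisation[of "B m" k] S C B(1)[OF m] by blast
    have le: "card {i. i < k \<and> b i < t + \<omega>} \<le> card {i. i < k \<and> b i \<le> t + \<omega>}" for t
      by (rule card_mono) auto
    note cm = orbit_ball_eigenvalue_counts[OF is_unitary_one V(1) B(2)[OF m, unfolded V(2)]]
    note cn = orbit_ball_eigenvalue_counts[OF is_unitary_one V(1) B(2)[OF n, folded eq, unfolded V(2)]]
    show "m = n"
    proof (rule sep[OF m n])
      fix t
      show "card {i. i < k \<and> a m i \<le> t} \<le> card {i. i < k \<and> a n i < t + 2 * \<omega>}"
        using cm(1)[of t] le[of t] cn(2)[of "t + \<omega>"] by (simp add: add.assoc)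
      show "card {i. i < k \<and> a n i \<le> t} \<le> card {i. i < k \<and> a m i < t + 2 * \<omega>}"
        using cn(1)[of t] le[of t] cm(2)[of "t + \<omega>"] by (simp add: add.assoc)
    qed
  qed
  then show ?thesis
    by (rule card_inj_on_le) (use B C in auto)
qed

section \<open>Packing numbers of bounded sets of reals\<close>

lemma finite_rational_grid:
  assumes "0 < (\<delta>::real)"
  shows "\<exists>Q. finite Q \<and> Q \<subseteq> \<rat> \<and> (\<forall>t. \<bar>t\<bar> \<le> M \<longrightarrow> (\<exists>q\<in>Q. \<bar>t - q\<bar> < \<delta>))"
proof -
  have "{- M..M} \<subseteq> (\<Union>q\<in>\<rat>. ball q \<delta>)"
  proof
    fix t :: real
    obtain q where "q \<in> \<rat>" "t < q" "q < t + \<delta>"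
      using Rats_dense_in_real[of t "t + \<delta>"] assms by auto
    then show "t \<in> (\<Union>q\<in>\<rat>. ball q \<delta>)"
      by (auto simp: dist_real_def intro!: bexI[of _ q])
  qed
  then obtain Q where "Q \<subseteq> \<rat>" "finite Q" "{- M..M} \<subseteq> (\<Union>q\<in>Q. ball q \<delta>)"
    using compactE_image[of "{- M..M}" \<rat> "\<lambda>q. ball q \<delta>"] by blast
  moreover have "\<exists>q\<in>Q. \<bar>t - q\<bar> < \<delta>" if "\<bar>t\<bar> \<le> M" for t
  proof -
    have "t \<in> {- M..M}"
      using that by auto
    with \<open>{- M..M} \<subseteq> (\<Union>q\<in>Q. ball q \<delta>)\<close> obtain q where "q \<in> Q" "t \<in> ball q \<delta>"
      by blast
    then show ?thesis
      by (auto simp: dist_real_def abs_minus_commute)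
  qed
  ultimately show ?thesis
    by blast
qed

text \<open>The points of a separated set round to different points of a grid of mesh \<open>\<omega>/2\<close>, so cardinalities are
  bounded and a largest separated set exists. By maximality every point of \<open>K\<close> lies within \<open>\<omega>\<close> of it.\<close>

lemma packing_number_attained:
  fixes K :: "real set"
  assumes K: "K \<noteq> {}" "\<And>t. t \<in> K \<Longrightarrow> \<bar>t\<bar> \<le> M" and \<omega>: "0 < \<omega>"
  shows "\<exists>F. finite F \<and> F \<noteq> {} \<and> F \<subseteq> K \<and> separated \<omega> F \<and> packing_number K \<omega> = enat (card F)
    \<and> (\<forall>t\<in>K. \<exists>s\<in>F. \<bar>t - s\<bar> < \<omega>)"
proof -
  let ?P = "\<lambda>F. finite F \<and> F \<subseteq> K \<and> separated \<omega> F"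
  obtain Q where Q: "finite Q" "\<And>t. \<bar>t\<bar> \<le> M \<Longrightarrow> \<exists>q\<in>Q. \<bar>t - q\<bar> < \<omega> / 2"
    using finite_rational_grid[of "\<omega> / 2" M] \<omega> by auto
  have bound: "card F \<le> card Q" if F: "?P F" for F
  proof -
    have "\<forall>t\<in>F. \<exists>q\<in>Q. \<bar>t - q\<bar> < \<omega> / 2"
      using Q K F by blast
    then obtain g where g: "\<And>t. t \<in> F \<Longrightarrow> g t \<in> Q" "\<And>t. t \<in> F \<Longrightarrow> \<bar>t - g t\<bar> < \<omega> / 2"
      by metis
    have "inj_on g F"
    proof (rule inj_onI)
      fix s t assume st: "s \<in> F" "t \<in> F" "g s = g t"
      then have "\<bar>s - t\<bar> < \<omega>"
        using g(2)[of s] g(2)[of t] by linarith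
      then show "s = t"
        using F st by (force simp: separated_def dist_real_def)
    qed
    then show ?thesis
      by (rule card_inj_on_le) (use g Q in auto)
  qed
  obtain t0 where t0: "t0 \<in> K"
    using K by blast
  have P0: "?P {t0}"
    using t0 by (simp add: separated_def)
  then obtain F where F: "?P F" and max: "\<And>F'. ?P F' \<Longrightarrow> card F' \<le> card F"
    using ex_has_greatest_nat[of ?P "{t0}" card "card Q + 1"] bound by (metis less_Suc_eq_le Suc_eq_plus1)
  have "packing_number K \<omega> = enat (card F)"
    unfolding packing_number_def by (rule Sup_eqI) (use F max in auto)
  moreover have "F \<noteq> {}"
    using max[OF P0] by auto
  moreover have "\<exists>s\<in>F. \<bar>t - s\<bar> < \<omega>" if t: "t \<in> K" for t
  proof (rule ccontr)
    assume far: "\<not> ?thesis"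
    then have "t \<notin> F"
      using \<omega> by auto
    moreover have "?P (insert t F)"
      using F t far by (auto simp: separated_def dist_real_def abs_minus_commute not_less)
    ultimately show False
      using max[of "insert t F"] F by simp
  qed
  ultimately show ?thesis
    using F by blast
qed

section \<open>Eigenvalues of microstates\<close>

lemma microstate_eigenvalues:
  assumes U: "is_unitary k U" and A: "rdiag k U a \<in> norm_microstates P x R k \<epsilon> r" and i: "i < k"
  shows "\<bar>a i\<bar> \<le> R"
    and "j \<in> {1..r} \<Longrightarrow> cmod (poly (P j) (complex_of_real (a i))) \<le> norm (poly_eval (P j) x) + \<epsilon>"
proof -
  have "\<bar>a i\<bar> \<le> mat_op_norm (rdiag k U a)"
    using mat_op_norm_udiag_ge[OF U i, of "\<lambda>i. complex_of_real (a i)"] by simp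
  then show "\<bar>a i\<bar> \<le> R"
    using A by (auto simp: norm_microstates_def)
  assume "j \<in> {1..r}"
  then have "mat_op_norm (mat_poly_eval k (P j) (rdiag k U a)) \<le> norm (poly_eval (P j) x) + \<epsilon>"
    using A by (force simp: norm_microstates_def)
  moreover have "cmod (poly (P j) (complex_of_real (a i)))
      \<le> mat_op_norm (mat_poly_eval k (P j) (rdiag k U a))"
    unfolding mat_poly_eval_udiag[OF U] by (rule mat_op_norm_udiag_ge[OF U i])
  ultimately show "cmod (poly (P j) (complex_of_real (a i))) \<le> norm (poly_eval (P j) x) + \<epsilon>"
    by linarith
qed

text \<open>If an eigenvalue \<open>l\<close> were at distance at least \<open>\<eta>\<close> from \<open>K\<close>, then for a grid point \<open>q\<close> near \<open>l\<close> the
  polynomial \<open>C - (X - q)\<^sup>2\<close> would be almost \<open>C\<close> at \<open>l\<close> but smaller than \<open>C\<close> by a multiple of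
  \<open>\<eta>\<^sup>2\<close> on \<open>K\<close>. For \<open>C\<close> large it is nonnegative on \<open>K\<close>, so the latter bounds \<open>\<parallel>p(x)\<parallel>\<close>. A grid in
  \<open>[- R, R]\<close> provides finitely many such polynomials, and they have rational coefficients.\<close>

lemma microstate_eigenvalues_near_spectrum:
  fixes x :: "'a::unital_cstar_algebra"
  assumes sa: "self_adjoint x" and P: "enumerates_rational_polys P" and \<eta>: "0 < \<eta>"
  shows "\<exists>r\<ge>1. \<exists>\<epsilon>>0. \<forall>k U a i. is_unitary k U \<longrightarrow> rdiag k U a \<in> norm_microstates P x R k \<epsilon> r
    \<longrightarrow> i < k \<longrightarrow> (\<exists>t\<in>real_spectrum x. \<bar>a i - t\<bar> < \<eta>)"
proof -
  obtain Q where Q: "finite Q" "Q \<subseteq> \<rat>" "\<And>t. \<bar>t\<bar> \<le> R \<Longrightarrow> \<exists>q\<in>Q. \<bar>t - q\<bar> < \<eta> / 4"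
    using finite_rational_grid[of "\<eta> / 4" R] \<eta> by auto
  define C where "C q = real (nat \<lceil>(norm x + \<bar>q\<bar>)\<^sup>2\<rceil>)" for q :: real
  have C: "(norm x + \<bar>q\<bar>)\<^sup>2 \<le> C q" "C q \<in> \<rat>" for q
    unfolding C_def by (rule real_nat_ceiling_ge, simp)
  define p where "p q = [:complex_of_real (C q - q\<^sup>2), complex_of_real (2 * q), - 1:]" for q
  have poly_p: "poly (p q) (complex_of_real t) = complex_of_real (C q - (t - q)\<^sup>2)" for q t
    by (simp add: p_def power2_eq_square algebra_simps)
  have "\<exists>j\<ge>1. P j = p q" if "q \<in> Q" for q
  proof -
    have "q \<in> \<rat>"
      using Q that by blast
    then have "\<forall>n. Re (coeff (p q) n) \<in> \<rat> \<and> Im (coeff (p q) n) \<in> \<rat>"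
      using C(2)[of q] by (auto simp: p_def coeff_pCons power2_eq_square split: nat.splits)
    then have "p q \<in> P ` {1..}"
      using P by (auto simp: enumerates_rational_polys_def)
    then show ?thesis
      by force
  qed
  then obtain idx where idx: "\<And>q. q \<in> Q \<Longrightarrow> idx q \<ge> (1::nat)" "\<And>q. q \<in> Q \<Longrightarrow> P (idx q) = p q"
    by metis
  define r where "r = Suc (\<Sum>q\<in>Q. idx q)"
  have r: "idx q \<in> {1..r}" if "q \<in> Q" for q
    using idx(1)[OF that] member_le_sum[of q Q idx] that Q by (simp add: r_def)
  have "\<exists>t\<in>real_spectrum x. \<bar>a i - t\<bar> < \<eta>"
    if U: "is_unitary k U" and A: "rdiag k U a \<in> norm_microstates P x R k (\<eta>\<^sup>2 / 4) r" and i: "i < k"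
    for k U a i
  proof (rule ccontr)
    assume far: "\<not> ?thesis"
    obtain q where q: "q \<in> Q" "\<bar>a i - q\<bar> < \<eta> / 4"
      using Q(3) microstate_eigenvalues(1)[OF U A i] by blast
    obtain t where t: "t \<in> real_spectrum x"
      "cmod (poly (p q) (complex_of_real t)) = norm (poly_eval (p q) x)"
      using poly_real_spectrum_attained[OF sa] by blast
    have "\<bar>t - q\<bar> \<le> norm x + \<bar>q\<bar>"
      using real_spectrum_abs_le[OF t(1)] by linarith
    then have "(t - q)\<^sup>2 \<le> (norm x + \<bar>q\<bar>)\<^sup>2"
      by (metis abs_ge_zero power2_abs power_mono)
    then have "(t - q)\<^sup>2 \<le> C q"
      using C(1)[of q] by linarith
    then have nrm: "norm (poly_eval (p q) x) = C q - (t - q)\<^sup>2"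
      unfolding t(2)[symmetric] poly_p norm_of_real by simp
    have "3 / 4 * \<eta> \<le> \<bar>t - q\<bar>"
    proof -
      have "\<eta> \<le> \<bar>a i - t\<bar>"
        using far t(1) by (meson not_le)
      then show ?thesis
        using q(2) by linarith
    qed
    then have "(3 / 4 * \<eta>)\<^sup>2 \<le> (t - q)\<^sup>2"
      using \<eta> by (metis abs_of_nonneg less_imp_le mult_nonneg_nonneg power2_abs power_mono
          zero_le_divide_iff zero_le_numeral)
    moreover have "(a i - q)\<^sup>2 \<le> (\<eta> / 4)\<^sup>2"
      using q(2) by (metis abs_ge_zero less_imp_le power2_abs power_mono)
    moreover have "C q - (a i - q)\<^sup>2 \<le> norm (poly_eval (p q) x) + \<eta>\<^sup>2 / 4"
    proof -
      have "\<bar>C q - (a i - q)\<^sup>2\<bar> \<le> norm (poly_eval (p q) x) + \<eta>\<^sup>2 / 4"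
        using microstate_eigenvalues(2)[OF U A i r[OF q(1)]]
        unfolding idx(2)[OF q(1)] poly_p norm_of_real .
      then show ?thesis
        by linarith
    qed
    moreover have "(3 / 4 * \<eta>)\<^sup>2 = 9 / 16 * \<eta>\<^sup>2" "(\<eta> / 4)\<^sup>2 = 1 / 16 * \<eta>\<^sup>2" "0 < \<eta>\<^sup>2"
      using \<eta> by (simp_all add: power_mult_distrib power_divide)
    ultimately show False
      unfolding nrm by linarith
  qed
  moreover have "r \<ge> 1" "\<eta>\<^sup>2 / 4 > 0"
    using \<eta> by (simp_all add: r_def)
  ultimately show ?thesis
    by blast
qed

section \<open>The upper bound\<close>

lemma norm_microstates_hermitian:
  "A \<in> norm_microstates P x R k \<epsilon> r \<Longrightarrow> A \<in> carrier_mat k k \<and> mat_adjoint A = A"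
  by (simp add: norm_microstates_def)

text \<open>Eigenvalues lie within \<open>\<omega>/8\<close> of \<open>K\<close>, and points of \<open>K\<close> within \<open>\<omega>/4\<close> of a maximal
  \<open>\<omega>/4\<close>-separated set. Together this is \<open>3\<omega>/8\<close>, whose double is still less than \<open>\<omega>\<close>.\<close>

lemma microstate_covering_number_upper:
  fixes x :: "'a::unital_cstar_algebra"
  assumes sa: "self_adjoint x" and P: "enumerates_rational_polys P" and \<omega>: "0 < \<omega>"
    and N: "packing_number (real_spectrum x) (\<omega> / 4) = enat N"
  shows "\<exists>r\<ge>1. \<exists>\<epsilon>>0. \<forall>k. orbit_covering_number k (norm_microstates P x R k \<epsilon> r) \<omega> \<le> (k + 1) ^ N"
proof -
  have "0 < \<omega> / 4"
    using \<omega> by simp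
  then obtain F where F: "finite F" "packing_number (real_spectrum x) (\<omega> / 4) = enat (card F)"
    "\<And>t. t \<in> real_spectrum x \<Longrightarrow> \<exists>s\<in>F. \<bar>t - s\<bar> < \<omega> / 4"
    using packing_number_attained[OF real_spectrum_nonempty[OF sa] real_spectrum_abs_le] by metis
  have card_F: "card F = N"
    using F(2) N by simp
  obtain r \<epsilon> where r: "r \<ge> 1" "\<epsilon> > 0" and near: "\<And>k U a i. is_unitary k U \<Longrightarrow>
      rdiag k U a \<in> norm_microstates P x R k \<epsilon> r \<Longrightarrow> i < k \<Longrightarrow> \<exists>t\<in>real_spectrum x. \<bar>a i - t\<bar> < \<omega> / 8"
    using microstate_eigenvalues_near_spectrum[OF sa P, of "\<omega> / 8" R] \<omega>
    by (metis divide_pos_pos zero_less_numeral)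
  have "orbit_covering_number k (norm_microstates P x R k \<epsilon> r) \<omega> \<le> (k + 1) ^ N" for k
  proof -
    let ?S = "norm_microstates P x R k \<epsilon> r"
    have "\<exists>C. finite C \<and> C \<subseteq> ?S \<and> ?S \<subseteq> (\<Union>B\<in>C. orbit_ball k B \<omega>) \<and> card C \<le> (k + 1) ^ card F"
    proof (rule orbit_cover_exists[OF norm_microstates_hermitian])
      fix U a i assume "is_unitary k U" "rdiag k U a \<in> ?S" "i < k"
      then obtain t where t: "t \<in> real_spectrum x" "\<bar>a i - t\<bar> < \<omega> / 8"
        using near by blast
      then obtain s where "s \<in> F" "\<bar>t - s\<bar> < \<omega> / 4"
        using F(3) by blast
      with t show "\<exists>s\<in>F. \<bar>a i - s\<bar> \<le> 3 * \<omega> / 8"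
        by (intro bexI[of _ s]) linarith+
    qed (use F(1) \<omega> in auto)
    then show ?thesis
      using orbit_covering_number_le card_F le_trans by blast
  qed
  with r show ?thesis
    by blast
qed

text \<open>For \<open>s \<le> 1\<close> the convention \<open>ln 0 = 0\<close> makes the left-hand side \<open>0\<close>, and the right-hand side is
  nonnegative.\<close>

lemma ln_ln_quotient_le:
  assumes s: "s \<le> (k + 1) ^ N" and k: "2 \<le> k" and N: "1 \<le> N"
  shows "ln (ln (real s) / ln (real k)) \<le> ln (real N * ln (real k + 1) / ln (real k))"
proof -
  have k': "0 < ln (real k)" "ln (real k) \<le> ln (real k + 1)"
    using k by simp_all
  have "1 * ln (real k) \<le> real N * ln (real k + 1)"
    using N k' by (intro mult_mono) auto
  then have ge1: "1 \<le> real N * ln (real k + 1) / ln (real k)"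
    using k' by (simp add: field_simps)
  show ?thesis
  proof (cases "s \<le> 1")
    case True
    then have "ln (real s) = 0"
      by (cases s) auto
    then show ?thesis
      using ge1 by simp
  next
    case False
    have "ln (real s) \<le> ln ((real k + 1) ^ N)"
      using s False of_nat_mono[OF s, where 'a = real] by (subst ln_le_cancel_iff) (auto simp: add.commute)
    also have "\<dots> = real N * ln (real k + 1)"
      by (simp add: ln_realpow)
    finally show ?thesis
      using False k' by (intro ln_mono divide_right_mono divide_pos_pos) auto
  qed
qed

lemma limsup_gauge_upper:
  fixes x :: "'a::unital_cstar_algebra"
  assumes sa: "self_adjoint x" and P: "enumerates_rational_polys P" and \<omega>: "0 < \<omega>" "\<omega> < 1"
    and N: "packing_number (real_spectrum x) (\<omega> / 4) = enat N" "1 \<le> N"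
  shows "(INF (r, \<epsilon>)\<in>{1..} \<times> {0<..}. limsup (\<lambda>k. ereal (ln (ln (real (orbit_covering_number k
      (norm_microstates P x R k \<epsilon> r) \<omega>)) / ln (real k)) / (- ln \<omega>)))) \<le> ereal (ln (real N) / (- ln \<omega>))"
proof -
  obtain r \<epsilon> where r: "r \<ge> 1" "\<epsilon> > 0"
    and le: "\<And>k. orbit_covering_number k (norm_microstates P x R k \<epsilon> r) \<omega> \<le> (k + 1) ^ N"
    using microstate_covering_number_upper[OF sa P \<omega>(1) N(1)] by metis
  have lnw: "0 < - ln \<omega>"
    using \<omega> by simp
  let ?u = "\<lambda>k. ln (real N * ln (real k + 1) / ln (real k)) / (- ln \<omega>)"
  have "limsup (\<lambda>k. ereal (ln (ln (real (orbit_covering_number k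
      (norm_microstates P x R k \<epsilon> r) \<omega>)) / ln (real k)) / (- ln \<omega>))) \<le> limsup (\<lambda>k. ereal (?u k))"
  proof (rule Limsup_mono, rule eventually_sequentiallyI[of 2])
    fix k :: nat assume "2 \<le> k"
    then show "ereal (ln (ln (real (orbit_covering_number k
      (norm_microstates P x R k \<epsilon> r) \<omega>)) / ln (real k)) / (- ln \<omega>)) \<le> ereal (?u k)"
      unfolding ereal_less_eq(3) using ln_ln_quotient_le[OF le] N(2) lnw by (intro divide_right_mono) auto
  qed
  also have "\<dots> = ereal (ln (real N) / (- ln \<omega>))"
  proof (rule lim_imp_Limsup)
    have "(\<lambda>k::nat. ln (real N * ln (real k + 1) / ln (real k))) \<longlonglongrightarrow> ln (real N)"
      using N(2) by real_asymp
    then show "(\<lambda>k. ereal (?u k)) \<longlonglongrightarrow> ereal (ln (real N) / (- ln \<omega>))"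
      unfolding lim_ereal using lnw by (intro tendsto_divide tendsto_const) auto
  qed simp
  finally show ?thesis
    using r by (intro INF_lower2[of "(r, \<epsilon>)"]) auto
qed

section \<open>The lower bound\<close>

text \<open>For \<open>1 < s < k\<close> the gauge is negative, and for fixed \<open>s\<close> it tends to \<open>-\<infinity>\<close> with growing \<open>k\<close>. For coarse
  parameters \<open>r\<close> and \<open>\<epsilon>\<close> such covering numbers are hard to exclude, but not for \<open>R < \<omega>/2\<close>: any
  microstate is then a centre for all others, whatever the parameters.\<close>

lemma orbit_covering_number_small_radius:
  assumes "2 * R < \<omega>" "0 < R"
  shows "orbit_covering_number k (norm_microstates P x R k \<epsilon> r) \<omega> \<le> 1"
proof (cases "norm_microstates P x R k \<epsilon> r = {}")
  case True
  then show ?thesis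
    using orbit_covering_number_le[of "{}" "norm_microstates P x R k \<epsilon> r" k \<omega>] by simp
next
  case False
  let ?S = "norm_microstates P x R k \<epsilon> r"
  obtain B where B: "B \<in> ?S"
    using False by blast
  then obtain V b where V: "is_unitary k V" "B = rdiag k V b"
    using norm_microstates_hermitian hermitian_diagonalisation by metis
  have "A \<in> orbit_ball k B \<omega>" if A: "A \<in> ?S" for A
  proof -
    obtain U a where U: "is_unitary k U" "A = rdiag k U a"
      using norm_microstates_hermitian[OF A] hermitian_diagonalisation by metis
    have "\<bar>a i - b i\<bar> \<le> 2 * R" if "i < k" for i
      using microstate_eigenvalues(1)[OF U(1) A[unfolded U(2)] that]
        microstate_eigenvalues(1)[OF V(1) B[unfolded V(2)] that] by linarith
    then show ?thesis
      unfolding U(2) V(2) using assms by (intro rdiag_in_orbit_ball[OF U(1) V(1), of "2 * R"]) auto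
  qed
  then show ?thesis
    using orbit_covering_number_le[of "{B}" ?S k \<omega>] B by auto
qed

text \<open>Eigenvalues in \<open>K\<close> keep \<open>\<parallel>p(A)\<parallel>\<close> at most \<open>\<parallel>p(x)\<parallel>\<close>. Equality for the polynomials \<open>P j\<close> holds once
  some eigenvalue is a point of \<open>K\<close> where \<open>P j\<close> attains its norm.\<close>

lemma diagonal_microstate:
  fixes x :: "'a::unital_cstar_algebra"
  assumes a: "\<And>i. i < k \<Longrightarrow> a i \<in> real_spectrum x"
    and attained: "\<And>j. j \<in> {1..r} \<Longrightarrow>
      \<exists>i<k. cmod (poly (P j) (complex_of_real (a i))) = norm (poly_eval (P j) x)"
    and "norm x \<le> R" "0 \<le> \<epsilon>"
  shows "rdiag k (1\<^sub>m k) a \<in> norm_microstates P x R k \<epsilon> r"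
proof -
  note one = is_unitary_one[of k]
  have "mat_op_norm (rdiag k (1\<^sub>m k) a) \<le> norm x"
    by (rule mat_op_norm_udiag_le[OF one]) (use a real_spectrum_abs_le in auto)
  moreover have "mat_op_norm (mat_poly_eval k (P j) (rdiag k (1\<^sub>m k) a)) = norm (poly_eval (P j) x)"
    if j: "j \<in> {1..r}" for j
  proof (rule antisym)
    show "mat_op_norm (mat_poly_eval k (P j) (rdiag k (1\<^sub>m k) a)) \<le> norm (poly_eval (P j) x)"
      unfolding mat_poly_eval_udiag[OF one]
      by (rule mat_op_norm_udiag_le[OF one]) (use a poly_real_spectrum_le in auto)
    show "norm (poly_eval (P j) x) \<le> mat_op_norm (mat_poly_eval k (P j) (rdiag k (1\<^sub>m k) a))"
      unfolding mat_poly_eval_udiag[OF one]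
      using attained[OF j] mat_op_norm_udiag_ge[OF one, of _ "\<lambda>i. poly (P j) (complex_of_real (a i))"]
      by metis
  qed
  moreover have "mat_adjoint (rdiag k (1\<^sub>m k) a) = rdiag k (1\<^sub>m k) a"
    by (simp add: udiag_adjoint)
  ultimately show ?thesis
    using assms(3,4) by (simp add: norm_microstates_def)
qed

lemma length_filter_concat_replicate:
  assumes "distinct ts"
  shows "length (filter Q (concat (map (\<lambda>t. replicate (f t) t) ts))) = (\<Sum>t\<in>set ts. if Q t then f t else 0)"
  using assms by (induction ts) auto

text \<open>The diagonal matrices have three kinds of entries: \<open>r\<close> entries at which \<open>P 1\<close> to \<open>P r\<close> attain their
  norms, \<open>(r + 1) * n t\<close> copies of each point \<open>t\<close> of \<open>F\<close> except the largest, with \<open>n t \<le> L\<close>, and the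
  largest point of \<open>F\<close> in the remaining places. Suppose that two functions \<open>m\<close> and \<open>n\<close> give
  matrices in one ball, and let \<open>t\<close> be the least point where they differ. As \<open>F\<close> is
  \<open>2 * \<omega>\<close>-separated, the counts up to \<open>t\<close> and below \<open>t + 2 * \<omega>\<close> see the same points of \<open>F\<close>, and
  below \<open>t\<close> the contributions agree. So \<open>(r + 1) * m t\<close> and \<open>(r + 1) * n t\<close> differ by at most the \<open>r\<close>
  entries of the first kind, which is impossible.\<close>

lemma microstate_covering_number_lower:
  fixes x :: "'a::unital_cstar_algebra" and F :: "real set"
  assumes sa: "self_adjoint x" and \<omega>: "0 < \<omega>" and R: "norm x \<le> R" and \<epsilon>: "0 \<le> \<epsilon>"
    and F: "finite F" "F \<subseteq> real_spectrum x" "separated (2 * \<omega>) F" "F \<noteq> {}"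
    and L: "r + (r + 1) * ((card F - 1) * L) \<le> k"
  shows "(L + 1) ^ (card F - 1) \<le> orbit_covering_number k (norm_microstates P x R k \<epsilon> r) \<omega>"
proof -
  let ?S = "norm_microstates P x R k \<epsilon> r"
  define top where "top = Max F"
  define F' where "F' = F - {top}"
  have top: "top \<in> F" "\<And>s. s \<in> F' \<Longrightarrow> s < top"
    using F by (auto simp: top_def F'_def less_le)
  have F': "finite F'" "card F' = card F - 1" "F' \<subseteq> F"
    using F top by (auto simp: F'_def)
  define ts where "ts = sorted_list_of_set F'"
  have ts: "distinct ts" "set ts = F'"
    using F' by (auto simp: ts_def)
  have "\<forall>j. \<exists>t\<in>real_spectrum x. cmod (poly (P j) (complex_of_real t)) = norm (poly_eval (P j) x)"
    using poly_real_spectrum_attained[OF sa] by blast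
  then obtain g where g: "\<And>j. g j \<in> real_spectrum x"
    "\<And>j. cmod (poly (P j) (complex_of_real (g j))) = norm (poly_eval (P j) x)"
    by metis
  define G where "G = map (\<lambda>i. g (Suc i)) [0..<r]"
  define I where "I = F' \<rightarrow>\<^sub>E {..L}"
  define mid where "mid n = concat (map (\<lambda>t. replicate ((r + 1) * n t) t) ts)" for n
  define xs where "xs n = G @ mid n @ replicate (k - r - (\<Sum>t\<in>F'. (r + 1) * n t)) top" for n
  have sum_le: "r + (\<Sum>t\<in>F'. (r + 1) * n t) \<le> k" if n: "n \<in> I" for n
  proof -
    have "(\<Sum>t\<in>F'. (r + 1) * n t) \<le> (\<Sum>t\<in>F'. (r + 1) * L)"
      using n by (intro sum_mono mult_left_mono) (auto simp: I_def PiE_iff)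
    also have "\<dots> = (r + 1) * ((card F - 1) * L)"
      unfolding sum_constant F'(2) of_nat_id by (rule mult.left_commute)
    finally show ?thesis
      using L by linarith
  qed
  have len_mid: "length (mid n) = (\<Sum>t\<in>F'. (r + 1) * n t)" for n
    using length_filter_concat_replicate[OF ts(1), of "\<lambda>_. True" "\<lambda>t. (r + 1) * n t"]
    by (simp add: mid_def ts(2) filter_True)
  have len_G: "length G = r"
    by (simp add: G_def)
  have len: "length (xs n) = k" if "n \<in> I" for n
    using sum_le[OF that] by (simp add: xs_def len_G len_mid)
  have set_xs: "set (xs n) \<subseteq> real_spectrum x" for n
    using g(1) F(2) F'(3) top(1) ts(2) by (auto simp: xs_def G_def mid_def set_replicate_conv_if split: if_splits)
  have in_S: "rdiag k (1\<^sub>m k) (\<lambda>i. xs n ! i) \<in> ?S" if n: "n \<in> I" for n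
  proof (rule diagonal_microstate)
    fix i assume "i < k"
    then show "xs n ! i \<in> real_spectrum x"
      using set_xs[of n] len[OF n] nth_mem by fastforce
  next
    fix j assume j: "j \<in> {1..r}"
    then have "j - 1 < r" "Suc (j - 1) = j"
      by auto
    then have "xs n ! (j - 1) = g j"
      by (simp add: xs_def nth_append len_G) (simp add: G_def)
    moreover have "j - 1 < k"
      using j sum_le[OF n] by auto
    ultimately show "\<exists>i<k. cmod (poly (P j) (complex_of_real (xs n ! i))) = norm (poly_eval (P j) x)"
      using g(2) by (intro exI[of _ "j - 1"]) simp
  qed (use R \<epsilon> in auto)
  have count: "card {i. i < k \<and> Q (xs n ! i)} = length (filter Q G)
      + (\<Sum>s\<in>F'. if Q s then (r + 1) * n s else 0)
      + (if Q top then k - r - (\<Sum>t\<in>F'. (r + 1) * n t) else 0)" if n: "n \<in> I" for n Q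
  proof -
    have "card {i. i < k \<and> Q (xs n ! i)} = length (filter Q (xs n))"
      using len[OF n] by (simp add: length_filter_conv_card)
    also have "\<dots> = length (filter Q G) + length (filter Q (mid n))
        + (if Q top then k - r - (\<Sum>t\<in>F'. (r + 1) * n t) else 0)"
      by (simp add: xs_def)
    also have "length (filter Q (mid n)) = (\<Sum>s\<in>F'. if Q s then (r + 1) * n s else 0)"
      unfolding mid_def length_filter_concat_replicate[OF ts(1)] ts(2) ..
    finally show ?thesis .
  qed
  have step: "m t \<le> n t"
    if mn: "m \<in> I" "n \<in> I" and t: "t \<in> F'" and eq: "\<And>s. s \<in> F' \<Longrightarrow> s < t \<Longrightarrow> m s = n s"
      and le: "card {i. i < k \<and> xs m ! i \<le> t} \<le> card {i. i < k \<and> xs n ! i < t + 2 * \<omega>}" for m n t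
  proof -
    have gap: "t + 2 * \<omega> \<le> s" if "s \<in> F" "t < s" for s
      using F(3) that t F'(3) by (force simp: separated_def dist_real_def)
    have below: "s < t + 2 * \<omega> \<longleftrightarrow> s \<le> t" if "s \<in> F" for s
      using gap[OF that] \<omega> by linarith
    have "(\<Sum>s\<in>F'. if s \<le> t then (r + 1) * m s else 0) \<le> card {i. i < k \<and> xs m ! i \<le> t}"
      unfolding count[OF mn(1), of "\<lambda>s. s \<le> t"] by simp
    also note le
    also have "card {i. i < k \<and> xs n ! i < t + 2 * \<omega>}
        = length (filter (\<lambda>s. s < t + 2 * \<omega>) G) + (\<Sum>s\<in>F'. if s \<le> t then (r + 1) * n s else 0)"
    proof -
      have "\<not> top < t + 2 * \<omega>"
        using below[OF top(1)] top(2)[OF t] by simp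
      moreover have "(\<Sum>s\<in>F'. if s < t + 2 * \<omega> then (r + 1) * n s else 0)
          = (\<Sum>s\<in>F'. if s \<le> t then (r + 1) * n s else 0)"
        by (rule sum.cong[OF refl]) (simp only: below[OF subsetD[OF F'(3)]])
      ultimately show ?thesis
        unfolding count[OF mn(2), of "\<lambda>s. s < t + 2 * \<omega>"] by (simp only: if_False add_0_right)
    qed
    also have "length (filter (\<lambda>s. s < t + 2 * \<omega>) G) \<le> r"
      using length_filter_le[of _ G] by (simp add: len_G)
    finally have *: "(\<Sum>s\<in>F'. if s \<le> t then (r + 1) * m s else 0)
        \<le> r + (\<Sum>s\<in>F'. if s \<le> t then (r + 1) * n s else 0)"
      by simp
    have split: "(\<Sum>s\<in>F'. if s \<le> t then (r + 1) * h s else 0)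
        = (r + 1) * h t + (\<Sum>s\<in>F' - {t}. if s < t then (r + 1) * h s else 0)" for h :: "real \<Rightarrow> nat"
      using F'(1) t by (subst sum.remove[of _ t]) (auto intro!: sum.cong simp: le_less)
    have "(\<Sum>s\<in>F' - {t}. if s < t then (r + 1) * m s else 0)
        = (\<Sum>s\<in>F' - {t}. if s < t then (r + 1) * n s else 0)"
      using eq by (intro sum.cong) auto
    with * have "(r + 1) * m t \<le> r + (r + 1) * n t"
      unfolding split by linarith
    then have "(r + 1) * m t < (r + 1) * (n t + 1)"
      by simp
    then show ?thesis
      by (metis Suc_eq_plus1 less_Suc_eq_le nat_mult_less_cancel1 mult_less_cancel1)
  qed
  \<comment> \<open>Boundedness of the microstates alone gives some finite cover, so the covering number is attained.\<close>
  obtain Q where Q: "finite Q" "\<And>t. \<bar>t\<bar> \<le> R \<Longrightarrow> \<exists>q\<in>Q. \<bar>t - q\<bar> < \<omega> / 4"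
    using finite_rational_grid[of "\<omega> / 4" R] \<omega> by auto
  have "\<exists>C. finite C \<and> C \<subseteq> ?S \<and> ?S \<subseteq> (\<Union>B\<in>C. orbit_ball k B \<omega>) \<and> card C \<le> (k + 1) ^ card Q"
  proof (rule orbit_cover_exists[OF norm_microstates_hermitian])
    fix U a i assume "is_unitary k U" "rdiag k U a \<in> ?S" "i < k"
    then have "\<bar>a i\<bar> \<le> R"
      by (rule microstate_eigenvalues(1))
    then show "\<exists>q\<in>Q. \<bar>a i - q\<bar> \<le> \<omega> / 4"
      using Q(2) by (meson less_imp_le)
  qed (use Q(1) \<omega> in auto)
  then obtain C where C: "finite C" "C \<subseteq> ?S" "?S \<subseteq> (\<Union>B\<in>C. orbit_ball k B \<omega>)"
    "card C = orbit_covering_number k ?S \<omega>"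
    using orbit_covering_number_attained by meson
  have "card I \<le> card C"
  proof (rule card_le_orbit_cover[OF norm_microstates_hermitian C(1-3) in_S])
    fix m n assume m: "m \<in> I" and n: "n \<in> I"
      and le: "\<And>t. card {i. i < k \<and> xs m ! i \<le> t} \<le> card {i. i < k \<and> xs n ! i < t + 2 * \<omega>}"
        "\<And>t. card {i. i < k \<and> xs n ! i \<le> t} \<le> card {i. i < k \<and> xs m ! i < t + 2 * \<omega>}"
    show "m = n"
    proof (rule ccontr)
      assume "m \<noteq> n"
      define D where "D = {t\<in>F'. m t \<noteq> n t}"
      have "D \<noteq> {}"
        using \<open>m \<noteq> n\<close> m n PiE_ext[of m F' "\<lambda>_. {..L}" n] by (auto simp: D_def I_def)
      moreover have "finite D"
        using F' by (simp add: D_def)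
      ultimately have D: "Min D \<in> D" "\<And>s. s \<in> D \<Longrightarrow> Min D \<le> s"
        by auto
      then have t: "Min D \<in> F'" and eq: "\<And>s. s \<in> F' \<Longrightarrow> s < Min D \<Longrightarrow> m s = n s"
        by (force simp: D_def)+
      have "m (Min D) = n (Min D)"
        using step[OF m n t eq le(1)] step[OF n m t eq[symmetric] le(2)] by simp
      with D(1) show False
        by (simp add: D_def)
    qed
  qed
  moreover have "card I = (L + 1) ^ (card F - 1)"
    using F' by (simp add: I_def card_PiE)
  ultimately show ?thesis
    using C(4) by simp
qed

text \<open>The largest \<open>L\<close> admissible in \<open>microstate_covering_number_lower\<close> is proportional to \<open>k\<close>. With
  \<open>s \<ge> (c * k)\<close> to the power \<open>N - 1\<close> the quotient \<open>ln s / ln k\<close> has lower limit at least \<open>N - 1\<close>.\<close>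

lemma limsup_gauge_lower:
  fixes x :: "'a::unital_cstar_algebra"
  assumes sa: "self_adjoint x" and \<omega>: "0 < \<omega>" "\<omega> < 1"
    and N: "packing_number (real_spectrum x) (2 * \<omega>) = enat N" "2 \<le> N"
    and r\<epsilon>: "0 \<le> \<epsilon>" and R: "norm x \<le> R"
  shows "ereal (ln (real N - 1) / (- ln \<omega>)) \<le> limsup (\<lambda>k. ereal (ln (ln (real (orbit_covering_number k
      (norm_microstates P x R k \<epsilon> r) \<omega>)) / ln (real k)) / (- ln \<omega>)))"
proof -
  have "0 < 2 * \<omega>"
    using \<omega> by simp
  then obtain F where F: "finite F" "F \<noteq> {}" "F \<subseteq> real_spectrum x" "separated (2 * \<omega>) F"
    "packing_number (real_spectrum x) (2 * \<omega>) = enat (card F)"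
    using packing_number_attained[OF real_spectrum_nonempty[OF sa] real_spectrum_abs_le] by metis
  have card_F: "card F = N"
    using F(5) N by simp
  have lnw: "0 < - ln \<omega>"
    using \<omega> by simp
  \<comment> \<open>The factor \<open>2\<close> absorbs the \<open>r\<close> entries that are set aside, once \<open>k \<ge> 2 * r\<close>.\<close>
  define c where "c = 1 / (2 * real ((r + 1) * (N - 1)))"
  have "0 < (r + 1) * (N - 1)"
    using N(2) by simp
  then have c: "0 < c"
    unfolding c_def by (intro divide_pos_pos mult_pos_pos) (simp_all only: of_nat_0_less_iff zero_less_numeral zero_less_one)
  define M where "M = real N - 1"
  have M: "0 < M" "M = real (N - 1)"
    using N by (auto simp: M_def of_nat_diff)
  let ?u = "\<lambda>k::nat. ln (M * ln (c * real k) / ln (real k)) / (- ln \<omega>)"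
  have "ereal (ln M / (- ln \<omega>)) = limsup (\<lambda>k. ereal (?u k))"
  proof (rule lim_imp_Limsup[symmetric])
    have "(\<lambda>k::nat. ln (M * ln (c * real k) / ln (real k))) \<longlonglongrightarrow> ln M"
      using c M(1) by real_asymp
    then show "(\<lambda>k. ereal (?u k)) \<longlonglongrightarrow> ereal (ln M / (- ln \<omega>))"
      unfolding lim_ereal using lnw by (intro tendsto_divide tendsto_const) auto
  qed simp
  also have "\<dots> \<le> limsup (\<lambda>k. ereal (ln (ln (real (orbit_covering_number k
      (norm_microstates P x R k \<epsilon> r) \<omega>)) / ln (real k)) / (- ln \<omega>)))"
  proof (rule Limsup_mono)
    have "eventually (\<lambda>k::nat. 1 < c * real k) sequentially"
      using c by real_asymp
    moreover have "eventually (\<lambda>k::nat. 2 * r + 2 \<le> k) sequentially"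
      by (rule eventually_ge_at_top)
    ultimately show "eventually (\<lambda>k. ereal (?u k) \<le> ereal (ln (ln (real (orbit_covering_number k
      (norm_microstates P x R k \<epsilon> r) \<omega>)) / ln (real k)) / (- ln \<omega>))) sequentially"
    proof eventually_elim
      case (elim k)
      define s where "s = orbit_covering_number k (norm_microstates P x R k \<epsilon> r) \<omega>"
      define q where "q = (r + 1) * (N - 1)"
      define L where "L = (k - r) div q"
      have q: "0 < q"
        using N by (simp add: q_def)
      have "q * L \<le> k - r"
        by (simp add: L_def)
      moreover have "(r + 1) * ((card F - 1) * L) = q * L"
        by (simp only: q_def card_F mult.assoc)
      ultimately have "r + (r + 1) * ((card F - 1) * L) \<le> k"
        using elim(2) by linarith
      then have s: "(L + 1) ^ (N - 1) \<le> s"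
        using microstate_covering_number_lower[OF sa \<omega>(1) R r\<epsilon> F(1,3,4,2), of r L k P]
        unfolding s_def card_F by blast
      have "k - r < q * (L + 1)"
        using mult_div_mod_eq[of q "k - r"] mod_less_divisor[OF q, of "k - r"]
        unfolding L_def distrib_left mult_1_right by linarith
      then have "k \<le> 2 * (q * (L + 1))"
        using elim(2) by linarith
      then have "real k \<le> 2 * real q * real (L + 1)"
        by (metis (no_types, lifting) mult.assoc of_nat_le_iff of_nat_mult of_nat_numeral)
      then have ck: "c * real k \<le> real (L + 1)"
        using q unfolding c_def q_def[symmetric] by (simp add: field_simps)
      have "M * ln (c * real k) \<le> M * ln (real (L + 1))"
        using M(1) ck elim(1) by (intro mult_left_mono ln_mono) auto
      also have "\<dots> = ln (real ((L + 1) ^ (N - 1)))"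
        by (simp only: M(2) of_nat_power) (simp add: ln_realpow)
      also have "\<dots> \<le> ln (real s)"
        using s by (intro ln_mono) (auto simp del: of_nat_power)
      finally have le: "M * ln (c * real k) \<le> ln (real s)" .
      have lnk: "0 < ln (real k)"
        using elim(2) by simp
      have "0 < M * ln (c * real k) / ln (real k)"
        using M(1) elim(1) lnk by simp
      then have "ln (M * ln (c * real k) / ln (real k)) \<le> ln (ln (real s) / ln (real k))"
        using le lnk by (intro ln_mono divide_right_mono) auto
      then show ?case
        unfolding ereal_less_eq(3) s_def using lnw by (intro divide_right_mono) auto
    qed
  qed
  finally show ?thesis
    unfolding M_def .
qed

section \<open>Comparison of the upper limits\<close>

text \<open>Replacing \<open>w\<close> by \<open>a * w\<close> adds the constant \<open>- ln a\<close> to \<open>- ln w\<close>. This constant and \<open>b\<close> are negligible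
  because \<open>- ln w\<close> tends to infinity.\<close>

lemma Limsup_log_rescale:
  fixes \<phi> \<psi> :: "real \<Rightarrow> real"
  assumes a: "0 < a" and \<phi>: "\<And>w. 0 < w \<Longrightarrow> 0 \<le> \<phi> w"
    and le: "\<And>w. 0 < w \<Longrightarrow> \<psi> w \<le> \<phi> (a * w) + b"
  shows "Limsup (at_right 0) (\<lambda>w. ereal (\<psi> w / (- ln w))) \<le> Limsup (at_right 0) (\<lambda>w. ereal (\<phi> w / (- ln w)))"
    (is "?L\<psi> \<le> ?L\<phi>")
proof -
  have "eventually (\<lambda>w. ereal (\<psi> w / (- ln w)) < y) (at_right 0)" if y: "?L\<phi> < y" for y
  proof -
    obtain z where z: "?L\<phi> < ereal z" "ereal z < y"
      using ereal_dense2[OF y] by blast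
    obtain z' where z': "z < z'" "ereal z' < y"
      using ereal_dense2[OF z(2)] by auto
    have "eventually (\<lambda>w. ereal (\<phi> w / (- ln w)) < ereal z) (at_right 0)"
      using z(1) Limsup_le_iff[of "at_right 0" "\<lambda>w. ereal (\<phi> w / (- ln w))" ?L\<phi>] by blast
    moreover have "filterlim (\<lambda>w. a * w) (at_right 0) (at_right (0::real))"
      using a by real_asymp
    ultimately have "eventually (\<lambda>w. ereal (\<phi> (a * w) / (- ln (a * w))) < ereal z) (at_right 0)"
      by (rule eventually_compose_filterlim)
    moreover have "eventually (\<lambda>w::real. 0 < w \<and> w < 1 \<and> a * w < 1) (at_right 0)"
      using a by (intro eventually_conj) real_asymp+
    moreover have "((\<lambda>w. (z * (- ln w - ln a) + b) / (- ln w)) \<longlongrightarrow> z) (at_right 0)"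
      by real_asymp
    then have "eventually (\<lambda>w. (z * (- ln w - ln a) + b) / (- ln w) < z') (at_right 0)"
      using z'(1) by (rule order_tendstoD)
    ultimately show ?thesis
    proof eventually_elim
      case (elim w)
      have "0 < - ln (a * w)" "0 < - ln w"
        using elim a by simp_all
      then have "\<phi> (a * w) < z * (- ln (a * w))"
        using elim(1) by (simp only: less_ereal.simps pos_divide_less_eq)
      also have "\<dots> = z * (- ln w - ln a)"
        using elim(2) a by (simp add: ln_mult)
      finally have "\<psi> w \<le> z * (- ln w - ln a) + b"
        using le[of w] elim(2) by linarith
      then have "\<psi> w / (- ln w) \<le> (z * (- ln w - ln a) + b) / (- ln w)"
        using \<open>0 < - ln w\<close> by (rule divide_right_mono[OF _ less_imp_le])
      then have "\<psi> w / (- ln w) < z'"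
        using elim(3) by linarith
      then show ?case
        using z'(2) by (meson ereal_less_eq(3) less_imp_le order_le_less_trans)
    qed
  qed
  then show ?thesis
    using Limsup_le_iff by blast
qed

theorem theorem7p1:
  fixes x :: "'a::unital_cstar_algebra"
    and P :: "nat \<Rightarrow> complex poly"
    and f :: "nat \<Rightarrow> nat \<Rightarrow> real \<Rightarrow> real"
  assumes "self_adjoint x"
    and "enumerates_rational_polys P"
    and "\<And>s k \<omega>. \<omega> > 0 \<Longrightarrow> f s k \<omega> = ln (ln (real s) / ln (real k)) / (- ln \<omega>)"
  shows "top_free_orbit_dim P f x = packing_dim (real_spectrum x)"
proof -
  note sa = assms(1) and P = assms(2)
  let ?K = "real_spectrum x"
  define gauge where "gauge R r \<epsilon> \<omega> k = ereal (ln (ln (real (orbit_covering_number k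
      (norm_microstates P x R k \<epsilon> r) \<omega>)) / ln (real k)) / (- ln \<omega>))" for R r \<epsilon> \<omega> k
  define g where "g \<omega> = (SUP R\<in>{0<..}. INF (r, \<epsilon>)\<in>{1..} \<times> {0<..}. limsup (gauge R r \<epsilon> \<omega>))" for \<omega>
  have unit_interval: "eventually (\<lambda>\<omega>::real. 0 < \<omega> \<and> \<omega> < 1) (at_right 0)"
    by (intro eventually_conj) real_asymp+
  have dim_eq: "top_free_orbit_dim P f x = Limsup (at_right 0) g"
    unfolding top_free_orbit_dim_def
    by (rule Limsup_eq, rule eventually_mono[OF unit_interval])
      (simp add: g_def gauge_def[abs_def] assms(3))
  have "\<exists>n. packing_number ?K \<omega> = enat n \<and> 1 \<le> n" if "0 < \<omega>" for \<omega>
    using packing_number_attained[OF real_spectrum_nonempty[OF sa] real_spectrum_abs_le that]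
    by (metis One_nat_def Suc_leI card_gt_0_iff)
  then obtain N where N: "\<And>\<omega>. 0 < \<omega> \<Longrightarrow> packing_number ?K \<omega> = enat (N \<omega>)" "\<And>\<omega>. 0 < \<omega> \<Longrightarrow> 1 \<le> N \<omega>"
    by metis
  have packing_eq: "packing_dim ?K = Limsup (at_right 0) (\<lambda>\<omega>. ereal (ln (real (N \<omega>)) / (- ln \<omega>)))"
    unfolding packing_dim_def
  proof (rule Limsup_eq, rule eventually_mono[OF unit_interval])
    fix \<omega> :: real assume \<omega>: "0 < \<omega> \<and> \<omega> < 1"
    then have "ln_enat (packing_number ?K \<omega>) = ereal (ln (real (N \<omega>)))"
      using N[of \<omega>] by (simp add: ln_enat_def)
    moreover have "- ln \<omega> \<noteq> 0"
      using \<omega> by simp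
    ultimately show "ln_enat (packing_number ?K \<omega>) / ereal (- ln \<omega>) = ereal (ln (real (N \<omega>)) / (- ln \<omega>))"
      by (simp only: ereal_divide if_False)
  qed
  show ?thesis
    unfolding dim_eq packing_eq
  proof (rule antisym)
    have "Limsup (at_right 0) g \<le> Limsup (at_right 0) (\<lambda>\<omega>. ereal (ln (real (N (\<omega> / 4))) / (- ln \<omega>)))"
    proof (rule Limsup_mono, rule eventually_mono[OF unit_interval])
      fix \<omega> :: real assume \<omega>: "0 < \<omega> \<and> \<omega> < 1"
      then show "g \<omega> \<le> ereal (ln (real (N (\<omega> / 4))) / (- ln \<omega>))"
        unfolding g_def gauge_def[abs_def]
        by (intro SUP_least limsup_gauge_upper[OF sa P]) (use N[of "\<omega> / 4"] in auto)
    qed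
    also have "\<dots> \<le> Limsup (at_right 0) (\<lambda>\<omega>. ereal (ln (real (N \<omega>)) / (- ln \<omega>)))"
      by (rule Limsup_log_rescale[where a = "1 / 4" and b = 0]) (use N in auto)
    finally show "Limsup (at_right 0) g \<le> Limsup (at_right 0) (\<lambda>\<omega>. ereal (ln (real (N \<omega>)) / (- ln \<omega>)))" .
  next
    \<comment> \<open>The value \<open>0\<close> for one-point packings comes from a small \<open>R\<close>, the other from \<open>R = \<parallel>x\<parallel> + 1\<close>.
      Passing from \<open>N\<close> to \<open>N - 1\<close> costs at most \<open>ln 2\<close>.\<close>
    define \<psi> where "\<psi> \<omega> = (if 2 \<le> N (2 * \<omega>) then ln (real (N (2 * \<omega>)) - 1) else 0)" for \<omega>
    have "Limsup (at_right 0) (\<lambda>\<omega>. ereal (ln (real (N \<omega>)) / (- ln \<omega>)))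
        \<le> Limsup (at_right 0) (\<lambda>\<omega>. ereal (\<psi> \<omega> / (- ln \<omega>)))"
    proof (rule Limsup_log_rescale[where a = "1 / 2" and b = "ln 2"])
      fix \<omega> :: real assume \<omega>: "0 < \<omega>"
      show "0 \<le> \<psi> \<omega>"
        by (simp add: \<psi>_def)
      show "ln (real (N \<omega>)) \<le> \<psi> (1 / 2 * \<omega>) + ln 2"
      proof (cases "2 \<le> N \<omega>")
        case True
        then have "ln (real (N \<omega>)) \<le> ln ((real (N \<omega>) - 1) * 2)"
          by (intro ln_mono) auto
        also have "\<dots> = ln (real (N \<omega>) - 1) + ln 2"
          using True by (intro ln_mult_pos) auto
        finally show ?thesis
          using True by (simp add: \<psi>_def)
      next
        case False
        then have "N \<omega> = 1"
          using N(2)[OF \<omega>] by simp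
        then show ?thesis
          by (simp add: \<psi>_def)
      qed
    qed simp
    also have "\<dots> \<le> Limsup (at_right 0) g"
    proof (rule Limsup_mono, rule eventually_mono[OF unit_interval])
      fix \<omega> :: real assume \<omega>: "0 < \<omega> \<and> \<omega> < 1"
      show "ereal (\<psi> \<omega> / (- ln \<omega>)) \<le> g \<omega>"
      proof (cases "2 \<le> N (2 * \<omega>)")
        case True
        have "ereal (\<psi> \<omega> / (- ln \<omega>)) \<le> (INF (r, \<epsilon>)\<in>{1..} \<times> {0<..}. limsup (gauge (norm x + 1) r \<epsilon> \<omega>))"
        proof (rule INF_greatest)
          fix i :: "nat \<times> real" assume "i \<in> {1..} \<times> {0<..}"
          then obtain r \<epsilon> where i: "i = (r, \<epsilon>)" "0 < \<epsilon>"
            by auto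
          then show "ereal (\<psi> \<omega> / (- ln \<omega>)) \<le> (case i of (r, \<epsilon>) \<Rightarrow> limsup (gauge (norm x + 1) r \<epsilon> \<omega>))"
            using limsup_gauge_lower[OF sa, of \<omega> "N (2 * \<omega>)" \<epsilon> "norm x + 1" P r] \<omega> True N(1)[of "2 * \<omega>"]
            by (simp add: \<psi>_def gauge_def[abs_def])
        qed
        also have "\<dots> \<le> g \<omega>"
          unfolding g_def by (rule SUP_upper) (simp add: add_nonneg_pos)
        finally show ?thesis .
      next
        case False
        have "gauge (\<omega> / 4) r \<epsilon> \<omega> = (\<lambda>_. 0)" for r \<epsilon>
        proof
          fix k
          have "orbit_covering_number k (norm_microstates P x (\<omega> / 4) k \<epsilon> r) \<omega> \<le> 1"
            using \<omega> by (intro orbit_covering_number_small_radius) auto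
          then have "ln (real (orbit_covering_number k (norm_microstates P x (\<omega> / 4) k \<epsilon> r) \<omega>)) = 0"
            by (cases "orbit_covering_number k (norm_microstates P x (\<omega> / 4) k \<epsilon> r) \<omega>") auto
          then show "gauge (\<omega> / 4) r \<epsilon> \<omega> k = 0"
            by (simp add: gauge_def)
        qed
        then have "limsup (gauge (\<omega> / 4) r \<epsilon> \<omega>) = 0" for r \<epsilon>
          by (simp add: Limsup_const)
        then have "ereal (\<psi> \<omega> / (- ln \<omega>)) \<le> (INF (r, \<epsilon>)\<in>{1..} \<times> {0<..}. limsup (gauge (\<omega> / 4) r \<epsilon> \<omega>))"
          using False by (intro INF_greatest) (auto simp: \<psi>_def zero_ereal_def)
        also have "\<dots> \<le> g \<omega>"
          unfolding g_def by (rule SUP_upper) (use \<omega> in auto)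
        finally show ?thesis .
      qed
    qed
    finally show "Limsup (at_right 0) (\<lambda>\<omega>. ereal (ln (real (N \<omega>)) / (- ln \<omega>))) \<le> Limsup (at_right 0) g" .
  qed
qed

end
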